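(* Let $\mathcal{F}:\mathcal{M}(\mathcal{X}\times\mathcal{Y})\to\mathbb{R}\cup\{+\infty\}$ be convex, lower semi-continuous and separably $*$-increasing, with some $\pi\in\Pi(\mathbb{P},\mathbb{Q})$ satisfying $\mathcal{F}(\pi)<\infty$. Let $\rho$ be a metric on $\Pi(\mathbb{P})$ and assume $\mathcal{F}$ is $\beta$-strongly convex on $\Pi(\mathbb{P})$ w.r.t. $\rho$ ($\beta>0$), and let $\pi^*$ be the OT plan. For $(\hat v,\hat\pi)\in\mathcal{C}(\mathcal{Y})\times\Pi(\mathbb{P})$ define the duality gaps $$\epsilon_1(\hat v,\hat\pi)=\mathcal{L}(\hat v,\hat\pi)-\inf_{\pi\in\Pi(\mathbb{P})}\mathcal{L}(\hat v,\pi),\qquad \epsilon_2(\hat v)=\sup_{v\in\mathcal{C}(\mathcal{Y})}\inf_{\pi\in\Pi(\mathbb{P})}\mathcal{L}(v,\pi)-\inf_{\pi\in\Pi(\mathbb{P})}\mathcal{L}(\hat v,\pi).$$ Then $$\rho(\hat\pi,\pi^* )\le\sqrt{\frac{2}{\beta}}\left(\sqrt{\epsilon_1(\hat v,\hat\pi)}+\sqrt{\epsilon_2(\hat v)}\right).$$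
   Context: Let $D\ge 1$ and let $\mathcal{X}=\mathcal{Y}\subset\mathbb{R}^D$ be compact; $\mathbb{P}\in\mathcal{P}(\mathcal{X})$, $\mathbb{Q}\in\mathcal{P}(\mathcal{Y})$. $\mathcal{C}(\mathcal{S})$ denotes continuous real functions, $\mathcal{M}(\mathcal{S})$ finite signed Borel measures, $\mathcal{P}(\mathcal{S})$ Borel probability measures; lower semi-continuity is w.r.t. the weak-$*$ topology. $\Pi(\mathbb{P})$: probability measures on $\mathcal{X}\times\mathcal{Y}$ with first marginal $\mathbb{P}$; $\Pi(\mathbb{P},\mathbb{Q})$: those with marginals $\mathbb{P},\mathbb{Q}$. $\mathcal{F}^*(h)=\sup_{\pi\in\mathcal{M}(\mathcal{X}\times\mathcal{Y})}[\int h\,d\pi-\mathcal{F}(\pi)]$. $\mathcal{F}$ is separably $*$-increasing if $u(x)+v(y)\le c(x,y)$ pointwise ($u\in\mathcal{C}(\mathcal{X}),v\in\mathcal{C}(\mathcal{Y}),c\in\mathcal{C}(\mathcal{X}\times\mathcal{Y})$) implies $\mathcal{F}^*(u\oplus v)\le\mathcal{F}^*(c)$, where $(u\oplus v)(x,y)=u(x)+v(y)$. The OT plan is the minimizer of $\mathcal{F}$ over $\Pi(\mathbb{P},\mathbb{Q})$. $\mathcal{L}(v,\pi)=\mathcal{F}(\pi)-\int_{\mathcal{Y}}v\,d\pi_{\mathcal{Y}}+\int_{\mathcal{Y}}v\,d\mathbb{Q}$ for $v\in\mathcal{C}(\mathcal{Y}),\pi\in\Pi(\mathbb{P})$, $\pi_{\mathcal{Y}}$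 the second marginal. Strong convexity: $\mathcal{F}$ is $\beta$-strongly convex on a convex set $\mathcal{U}$ w.r.t. metric $\rho$ if for all $\pi_1,\pi_2\in\mathcal{U}$, $\alpha\in[0,1]$: $\mathcal{F}(\alpha\pi_1+(1-\alpha)\pi_2)\le\alpha\mathcal{F}(\pi_1)+(1-\alpha)\mathcal{F}(\pi_2)-\frac{\beta}{2}\alpha(1-\alpha)\rho^2(\pi_1,\pi_2)$. *)

theory Defs
  imports "HOL-Probability.Probability"
begin

text \<open>Finite signed Borel measures on a (Borel) set S, represented as real-valued
set functions (zero on non-Borel sets) arising as differences of two finite
Borel measures concentrated on S (Jordan decomposition).\<close>

definition smeasures :: "'b::topological_space set \<Rightarrow> ('b set \<Rightarrow> real) set" where
  "smeasures S = {\<mu>. \<exists>M1 M2. finite_measure M1 \<and> finite_measure M2 \<and>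
      sets M1 = sets borel \<and> sets M2 = sets borel \<and>
      emeasure M1 (- S) = 0 \<and> emeasure M2 (- S) = 0 \<and>
      \<mu> = (\<lambda>A. if A \<in> sets borel then measure M1 A - measure M2 A else 0)}"

definition pmeasures :: "'b::topological_space set \<Rightarrow> ('b set \<Rightarrow> real) set" where
  "pmeasures S = {\<lambda>A. if A \<in> sets borel then measure M A else 0 | M.
      prob_space M \<and> sets M = sets borel \<and> emeasure M (- S) = 0}"

definition sint :: "'b::topological_space set \<Rightarrow> ('b set \<Rightarrow> real) \<Rightarrow> ('b \<Rightarrow> real) \<Rightarrow> real" where
  "sint S \<mu> h = (SOME r. \<exists>M1 M2. finite_measure M1 \<and> finite_measure M2 \<and>
      sets M1 = sets borel \<and> sets M2 = sets borel \<and>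
      emeasure M1 (- S) = 0 \<and> emeasure M2 (- S) = 0 \<and>
      \<mu> = (\<lambda>A. if A \<in> sets borel then measure M1 A - measure M2 A else 0) \<and>
      r = integral\<^sup>L M1 (\<lambda>x. if x \<in> S then h x else 0)
        - integral\<^sup>L M2 (\<lambda>x. if x \<in> S then h x else 0))"

definition fst_marg :: "(('a::topological_space \<times> 'b::topological_space) set \<Rightarrow> real) \<Rightarrow> 'a set \<Rightarrow> real" where
  "fst_marg \<pi> = (\<lambda>A. if A \<in> sets borel then \<pi> (A \<times> UNIV) else 0)"

definition snd_marg :: "(('a::topological_space \<times> 'b::topological_space) set \<Rightarrow> real) \<Rightarrow> 'b set \<Rightarrow> real" where
  "snd_marg \<pi> = (\<lambda>B. if B \<in> sets borel then \<pi> (UNIV \<times> B) else 0)"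

text \<open>\<Pi>(P): probability measures on X \<times> Y with first marginal P (here X = Y = K).\<close>
definition couplings1 :: "'a::topological_space set \<Rightarrow> ('a set \<Rightarrow> real) \<Rightarrow> (('a \<times> 'a) set \<Rightarrow> real) set" where
  "couplings1 K P = {\<pi> \<in> pmeasures (K \<times> K). fst_marg \<pi> = P}"

definition couplings :: "'a::topological_space set \<Rightarrow> ('a set \<Rightarrow> real) \<Rightarrow> ('a set \<Rightarrow> real) \<Rightarrow> (('a \<times> 'a) set \<Rightarrow> real) set" where
  "couplings K P Q = {\<pi> \<in> pmeasures (K \<times> K). fst_marg \<pi> = P \<and> snd_marg \<pi> = Q}"

definition mix :: "real \<Rightarrow> ('b set \<Rightarrow> real) \<Rightarrow> ('b set \<Rightarrow> real) \<Rightarrow> 'b set \<Rightarrow> real" where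
  "mix \<alpha> \<mu> \<nu> = (\<lambda>A. \<alpha> * \<mu> A + (1 - \<alpha>) * \<nu> A)"

definition convex_sm :: "('b set \<Rightarrow> real) set \<Rightarrow> (('b set \<Rightarrow> real) \<Rightarrow> ereal) \<Rightarrow> bool" where
  "convex_sm U F \<longleftrightarrow> (\<forall>\<mu>\<in>U. \<forall>\<nu>\<in>U. \<forall>\<alpha>\<in>{0..1}.
      F (mix \<alpha> \<mu> \<nu>) \<le> ereal \<alpha> * F \<mu> + ereal (1 - \<alpha>) * F \<nu>)"

definition strongly_convex_sm ::
  "('b set \<Rightarrow> real) set \<Rightarrow> (('b set \<Rightarrow> real) \<Rightarrow> ereal) \<Rightarrow> (('b set \<Rightarrow> real) \<Rightarrow> ('b set \<Rightarrow> real) \<Rightarrow> real) \<Rightarrow> real \<Rightarrow> bool" where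
  "strongly_convex_sm U F \<rho> \<beta> \<longleftrightarrow> (\<forall>\<mu>\<in>U. \<forall>\<nu>\<in>U. \<forall>\<alpha>\<in>{0..1}.
      F (mix \<alpha> \<mu> \<nu>) \<le> ereal \<alpha> * F \<mu> + ereal (1 - \<alpha>) * F \<nu>
        - ereal (\<beta> / 2 * \<alpha> * (1 - \<alpha>) * (\<rho> \<mu> \<nu>)\<^sup>2))"

definition metric_on_set :: "'c set \<Rightarrow> ('c \<Rightarrow> 'c \<Rightarrow> real) \<Rightarrow> bool" where
  "metric_on_set U \<rho> \<longleftrightarrow> (\<forall>x\<in>U. \<forall>y\<in>U. (\<rho> x y = 0 \<longleftrightarrow> x = y) \<and> \<rho> x y = \<rho> y x \<and>
      (\<forall>z\<in>U. \<rho> x z \<le> \<rho> x y + \<rho> y z))"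

text \<open>Lower semicontinuity w.r.t. the weak-* topology on M(S) (the initial topology of the
maps \<mu> \<mapsto> \<integral> h d\<mu>, h \<in> C(S)), stated via its basic neighbourhoods.\<close>
definition wstar_lsc :: "'b::topological_space set \<Rightarrow> (('b set \<Rightarrow> real) \<Rightarrow> ereal) \<Rightarrow> bool" where
  "wstar_lsc S F \<longleftrightarrow> (\<forall>\<mu>\<in>smeasures S. \<forall>t. t < F \<mu> \<longrightarrow>
      (\<exists>H e. finite H \<and> (\<forall>h\<in>H. continuous_on S h) \<and> e > 0 \<and>
        (\<forall>\<nu>\<in>smeasures S. (\<forall>h\<in>H. \<bar>sint S \<nu> h - sint S \<mu> h\<bar> < e) \<longrightarrow> t < F \<nu>)))"

definition Fstar :: "'b::topological_space set \<Rightarrow> (('b set \<Rightarrow> real) \<Rightarrow> ereal) \<Rightarrow> ('b \<Rightarrow> real) \<Rightarrow> ereal" where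
  "Fstar S F h = (SUP \<pi>\<in>smeasures S. ereal (sint S \<pi> h) - F \<pi>)"

definition sep_star_incr :: "'a::topological_space set \<Rightarrow> ((('a \<times> 'a) set \<Rightarrow> real) \<Rightarrow> ereal) \<Rightarrow> bool" where
  "sep_star_incr K F \<longleftrightarrow> (\<forall>u v c. continuous_on K u \<and> continuous_on K v \<and>
      continuous_on (K \<times> K) c \<and> (\<forall>x\<in>K. \<forall>y\<in>K. u x + v y \<le> c (x, y)) \<longrightarrow>
      Fstar (K \<times> K) F (\<lambda>(x, y). u x + v y) \<le> Fstar (K \<times> K) F c)"

definition Lagr :: "'a::topological_space set \<Rightarrow> ((('a \<times> 'a) set \<Rightarrow> real) \<Rightarrow> ereal) \<Rightarrow> ('a set \<Rightarrow> real)
    \<Rightarrow> ('a \<Rightarrow> real) \<Rightarrow> (('a \<times> 'a) set \<Rightarrow> real) \<Rightarrow> ereal" where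
  "Lagr K F Q v \<pi> = F \<pi> - ereal (sint K (snd_marg \<pi>) v) + ereal (sint K Q v)"

definition eps1 where
  "eps1 K F P Q vh \<pi>h = Lagr K F Q vh \<pi>h - (INF \<pi>\<in>couplings1 K P. Lagr K F Q vh \<pi>)"

definition eps2 where
  "eps2 K F P Q vh = (SUP v\<in>{v. continuous_on K v}. INF \<pi>\<in>couplings1 K P. Lagr K F Q v \<pi>)
      - (INF \<pi>\<in>couplings1 K P. Lagr K F Q vh \<pi>)"

text \<open>Square root on extended reals (sqrt \<infinity> = \<infinity>; negative arguments do not occur).\<close>
definition esqrt :: "ereal \<Rightarrow> ereal" where
  "esqrt x = (if x = \<infinity> then \<infinity> else if x = -\<infinity> then 0 else ereal (sqrt (real_of_ereal x)))"

end

theory Submission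
  imports Defs
begin

text \<open>
  The Lagrangian at a fixed potential is strongly convex on \<open>\<Pi>(P)\<close>, so a plan whose value exceeds the infimum
  by \<open>\<epsilon>\<close> lies within about \<open>\<surd>(2 \<epsilon> / \<beta>)\<close> of every sufficiently good near-minimizer; no minimizer is needed.
  Applying this to \<open>\<pi>hat\<close> (excess \<open>\<epsilon>\<^sub>1\<close>) and to \<open>\<pi>star\<close> (excess at most \<open>\<epsilon>\<^sub>2\<close>) and using the
  triangle inequality gives the bound.  That the excess of \<open>\<pi>star\<close> is at most \<open>\<epsilon>\<^sub>2\<close> is strong duality, which
  follows from a finite minimax lemma and weak-* sequential compactness of the probability measures on a compact set.
\<close>

section \<open>Measures as set functions\<close>

text \<open>The second marginal of \<open>\<pi>star\<close> is \<open>Q\<close>, so the potential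
  terms cancel and its Lagrangian equals \<open>F \<pi>star\<close> for every potential; what
  duality has to supply is that this value is at most the sup-inf. The obstacle is that the
  potentials form an infinite family, whereas a separation argument in finite dimension handles
  finitely many real functions. The constraint on the second marginal is therefore tested on
  countably many functions, each multiplied by integers of both signs, which act as ever larger
  penalties. Finite parts of this family yield a sequence of plans, and lower semicontinuity bounds
  \<open>F\<close> at a limit of it. In the final estimate the given plan gets mixing weight
  \<open>d\<close> and the near-minimizer is allowed an error of \<open>d^2\<close>: strong
  convexity gains a term of order \<open>d\<close>, so dividing by \<open>d\<close> leaves an error
  that vanishes with \<open>d\<close>.\<close>

definition prob_on :: "'b::topological_space set \<Rightarrow> 'b measure \<Rightarrow> bool" where
  "prob_on S M \<longleftrightarrow> prob_space M \<and> sets M = sets borel \<and> emeasure M (- S) = 0"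

text \<open>The problem is posed for real set functions, while integration theory works with
  measures; this is the passage between them, in the form used by \<open>pmeasures\<close>.\<close>

definition set_fun :: "'b::topological_space measure \<Rightarrow> 'b set \<Rightarrow> real" where
  "set_fun M = (\<lambda>A. if A \<in> sets borel then measure M A else 0)"

text \<open>The integrand that occurs in \<open>sint\<close>. For compact \<open>S\<close>,
  extension by zero turns a function continuous on \<open>S\<close> into a bounded Borel function on
  the whole space.\<close>

definition cutoff :: "'b set \<Rightarrow> ('b \<Rightarrow> real) \<Rightarrow> 'b \<Rightarrow> real" where
  "cutoff S h = (\<lambda>x. if x \<in> S then h x else 0)"

lemma pmeasures_iff: "\<pi> \<in> pmeasures S \<longleftrightarrow> (\<exists>M. prob_on S M \<and> \<pi> = set_fun M)"
  by (auto simp: pmeasures_def prob_on_def set_fun_def)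

lemma nn_integral_lincomb:
  assumes [measurable_cong]: "sets N = sets M1" "sets M2 = sets M1"
    and eq: "\<And>A. A \<in> sets M1 \<Longrightarrow> emeasure N A = a * emeasure M1 A + b * emeasure M2 A"
    and u: "u \<in> borel_measurable M1"
  shows "(\<integral>\<^sup>+x. u x \<partial>N) = a * (\<integral>\<^sup>+x. u x \<partial>M1) + b * (\<integral>\<^sup>+x. u x \<partial>M2)"
  using u
proof (induction rule: borel_measurable_induct)
  case (cong f g)
  have [simp]: "space N = space M1" "space M2 = space M1"
    using assms(1,2) by (auto dest: sets_eq_imp_space_eq)
  have "integral\<^sup>N L f = integral\<^sup>N L g" if "space L = space M1" for L
    using cong(3) that by (intro nn_integral_cong) auto
  with cong(4) show ?case by simp
next
  case (set A)
  then show ?case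
    using eq[OF set] assms by simp
next
  case (mult u c)
  then show ?case
    by (simp add: nn_integral_cmult ring_distribs mult_ac)
next
  case (add u v)
  then show ?case
    by (simp add: nn_integral_add ring_distribs add_ac)
next
  case (seq U)
  have "(\<integral>\<^sup>+x. (SUP i. U i) x \<partial>L) = (SUP i. \<integral>\<^sup>+x. U i x \<partial>L)" if "sets L = sets M1" for L
    unfolding SUP_apply
    using seq that by (intro nn_integral_monotone_convergence_SUP) (auto cong: measurable_cong_sets)
  moreover have "incseq (\<lambda>i. c * (\<integral>\<^sup>+x. U i x \<partial>L))" for L c
    using \<open>incseq U\<close> by (auto simp: incseq_def le_fun_def intro!: mult_left_mono nn_integral_mono)
  ultimately show ?case
    using assms(1,2) seq by (simp add: SUP_mult_left_ennreal ennreal_SUP_add)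
qed

text \<open>Serves twice: with \<open>a = b = 1\<close> it shows that \<open>sint\<close> does not
  depend on the chosen decomposition, and with weights adding to 1 that \<open>sint\<close> is
  affine along mixtures. Boundedness keeps the integrals of the positive and negative parts finite,
  so they may be subtracted.\<close>

lemma integral_lincomb:
  fixes u :: "'b \<Rightarrow> real"
  assumes "finite_measure N" "finite_measure M1" "finite_measure M2"
    and sets: "sets N = sets M1" "sets M2 = sets M1" and "0 \<le> a" "0 \<le> b"
    and eq: "\<And>A. A \<in> sets M1 \<Longrightarrow> measure N A = a * measure M1 A + b * measure M2 A"
    and u: "u \<in> borel_measurable M1" and bound: "\<And>x. \<bar>u x\<bar> \<le> B"
  shows "integral\<^sup>L N u = a * integral\<^sup>L M1 u + b * integral\<^sup>L M2 u"
proof -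
  interpret N: finite_measure N by fact
  interpret M1: finite_measure M1 by fact
  interpret M2: finite_measure M2 by fact
  have eq': "emeasure N A = ennreal a * emeasure M1 A + ennreal b * emeasure M2 A" if "A \<in> sets M1" for A
    using eq[OF that] \<open>0 \<le> a\<close> \<open>0 \<le> b\<close>
    by (simp add: N.emeasure_eq_measure M1.emeasure_eq_measure M2.emeasure_eq_measure
        ennreal_mult)
  have [measurable]: "u \<in> borel_measurable N" "u \<in> borel_measurable M1" "u \<in> borel_measurable M2"
    using u sets by (auto cong: measurable_cong_sets)
  have int: "integrable N u" "integrable M1 u" "integrable M2 u"
    using bound by (auto intro!: N.integrable_const_bound[where B=B] M1.integrable_const_bound[where B=B]
        M2.integrable_const_bound[where B=B])
  \<comment> \<open>\<open>ennreal\<close> truncates at 0, so this is the claim for positive parts;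
    it is applied to \<open>u\<close> and to \<open>- u\<close>.\<close>
  have *: "enn2real (\<integral>\<^sup>+x. ennreal (w x) \<partial>N) =
     a * enn2real (\<integral>\<^sup>+x. ennreal (w x) \<partial>M1) + b * enn2real (\<integral>\<^sup>+x. ennreal (w x) \<partial>M2)"
    if w: "w \<in> borel_measurable M1" "integrable M1 w" "integrable M2 w" for w
  proof -
    have fin: "(\<integral>\<^sup>+x. ennreal (w x) \<partial>M1) < \<infinity>" "(\<integral>\<^sup>+x. ennreal (w x) \<partial>M2) < \<infinity>"
      using w(2,3) by (auto simp: real_integrable_def less_top)
    show ?thesis
      using nn_integral_lincomb[OF sets eq', of "\<lambda>x. ennreal (w x)"] w(1) fin \<open>0 \<le> a\<close> \<open>0 \<le> b\<close>
      by (simp add: enn2real_plus ennreal_mult_less_top enn2real_mult)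
  qed
  show ?thesis
    using *[of u] *[of "\<lambda>x. - u x"] int
    by (simp add: real_lebesgue_integral_def algebra_simps)
qed

lemma borel_measurable_cutoff:
  assumes "compact S" "continuous_on S h"
  shows "cutoff S h \<in> borel_measurable (borel :: 'b::t2_space measure)"
proof -
  have "S \<in> sets borel"
    using assms by (simp add: compact_imp_closed borel_closed)
  then show ?thesis
    using borel_measurable_continuous_on_if[of S h "\<lambda>_. 0"] assms by (simp add: cutoff_def)
qed

lemma cutoff_bounded:
  assumes "compact S" "continuous_on S h"
  obtains B where "0 \<le> B" "\<And>x. \<bar>cutoff S h x\<bar> \<le> B"
proof -
  have "bounded (h ` S)"
    using assms by (simp add: compact_continuous_image compact_imp_bounded)
  then obtain B where "\<And>x. x \<in> S \<Longrightarrow> \<bar>h x\<bar> \<le> B"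
    by (auto simp: bounded_iff)
  then show ?thesis
    by (intro that[of "\<bar>B\<bar>"]) (fastforce simp: cutoff_def)+
qed

lemma integrable_cutoff:
  assumes "compact S" "continuous_on S h" "prob_on (S :: 'b::t2_space set) M"
  shows "integrable M (cutoff S h)"
proof -
  interpret prob_space M using assms(3) by (simp add: prob_on_def)
  obtain B where "\<And>x. \<bar>cutoff S h x\<bar> \<le> B" using cutoff_bounded assms by metis
  then show ?thesis
    using borel_measurable_cutoff[OF assms(1,2)] assms(3)
    by (intro integrable_const_bound[where B=B]) (auto simp: prob_on_def cong: measurable_cong_sets)
qed

text \<open>\<open>sint\<close> chooses an arbitrary decomposition \<open>M1 - M2\<close>. If the
  set function also comes from \<open>M\<close>, then \<open>M1 = M + M2\<close> on Borel sets, an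
  identity between nonnegative measures that can be integrated; hence every choice gives the same
  value. The pair of \<open>M\<close> and the null measure shows that a choice exists.\<close>

lemma sint_set_fun:
  fixes S :: "'b::t2_space set"
  assumes S: "compact S" "continuous_on S h" and M: "prob_on S M"
  shows "sint S (set_fun M) h = integral\<^sup>L M (cutoff S h)"
proof -
  interpret M: prob_space M using M by (simp add: prob_on_def)
  have null: "finite_measure (null_measure borel)"
    by (rule finite_measureI) simp
  let ?P = "\<lambda>r M1 M2. finite_measure M1 \<and> finite_measure M2 \<and>
      sets M1 = sets borel \<and> sets M2 = sets borel \<and>
      emeasure M1 (- S) = 0 \<and> emeasure M2 (- S) = 0 \<and>
      set_fun M = (\<lambda>A. if A \<in> sets borel then measure M1 A - measure M2 A else 0) \<and>
      r = integral\<^sup>L M1 (cutoff S h) - integral\<^sup>L M2 (cutoff S h)"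
  have "?P (integral\<^sup>L M (cutoff S h)) M (null_measure borel)"
    using M null by (auto simp: prob_on_def set_fun_def measure_def M.finite_measure_axioms)
  moreover have "r = integral\<^sup>L M (cutoff S h)" if P: "?P r M1 M2" for r M1 M2
  proof -
    obtain B where "\<And>x. \<bar>cutoff S h x\<bar> \<le> B" using cutoff_bounded S by metis
    then have "integral\<^sup>L M1 (cutoff S h) = 1 * integral\<^sup>L M (cutoff S h) + 1 * integral\<^sup>L M2 (cutoff S h)"
    proof (rule integral_lincomb[rotated -1])
      show "measure M1 A = 1 * measure M A + 1 * measure M2 A" if "A \<in> sets M" for A
      proof -
        have "set_fun M A = measure M1 A - measure M2 A"
          using P that M by (simp add: prob_on_def)
        then show ?thesis using that M by (simp add: set_fun_def prob_on_def)
      qed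
    qed (use P M borel_measurable_cutoff[OF S] in
          \<open>auto simp: prob_on_def M.finite_measure_axioms cong: measurable_cong_sets\<close>)
    then show ?thesis using P by simp
  qed
  ultimately show ?thesis
    unfolding sint_def cutoff_def[symmetric] by (intro some_equality) blast+
qed

lemma prob_on_mix:
  assumes M: "prob_on S M" and N: "prob_on S N" and \<alpha>: "0 \<le> \<alpha>" "\<alpha> \<le> 1" and "- S \<in> sets borel"
  obtains L where "prob_on S L" "set_fun L = mix \<alpha> (set_fun M) (set_fun N)"
proof -
  interpret M: prob_space M using M by (simp add: prob_on_def)
  interpret N: prob_space N using N by (simp add: prob_on_def)
  have sets: "sets M = sets borel" "sets N = sets borel" and [simp]: "space M = UNIV" "space N = UNIV"
    using M N by (auto simp: prob_on_def dest: sets_eq_imp_space_eq)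
  let ?f = "\<lambda>A. ennreal \<alpha> * emeasure M A + ennreal (1 - \<alpha>) * emeasure N A"
  define L where "L = measure_of UNIV (sets borel) ?f"
  have L: "emeasure L A = ?f A" if "A \<in> sets borel" for A
    unfolding L_def
  proof (rule emeasure_measure_of_sigma)
    show "sigma_algebra UNIV (sets borel)"
      using sets.sigma_algebra_axioms[of borel] by simp
    show "positive (sets borel) ?f"
      by (simp add: positive_def)
    show "countably_additive (sets borel) ?f"
      using sets
      by (auto simp: countably_additive_def suminf_emeasure suminf_add[symmetric] ennreal_suminf_cmult
          image_subset_iff)
  qed fact
  have sL: "sets L = sets borel"
    using sets.sigma_sets_eq[of borel] by (simp add: L_def)
  have m: "emeasure L A = ennreal (\<alpha> * measure M A + (1 - \<alpha>) * measure N A)" if "A \<in> sets borel" for A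
    using L[OF that] \<alpha> by (simp add: M.emeasure_eq_measure N.emeasure_eq_measure
        ennreal_mult)
  have "prob_space L"
    using m[of UNIV] M.prob_space N.prob_space sets_eq_imp_space_eq[OF sL] by (intro prob_spaceI) simp
  moreover have "measure L A = \<alpha> * measure M A + (1 - \<alpha>) * measure N A" if "A \<in> sets borel" for A
    using m[OF that] \<alpha> unfolding measure_def[of L] by (simp del: ennreal_plus)
  moreover have "emeasure L (- S) = 0"
    using L[OF \<open>- S \<in> sets borel\<close>] M N by (simp add: prob_on_def)
  ultimately show ?thesis
    using sL by (intro that[of L]) (auto simp: prob_on_def set_fun_def mix_def)
qed

lemma sint_mix:
  fixes S :: "'b::t2_space set"
  assumes S: "compact S" "continuous_on S h" and "\<mu> \<in> pmeasures S" "\<nu> \<in> pmeasures S"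
    and \<alpha>: "0 \<le> \<alpha>" "\<alpha> \<le> 1"
  shows "sint S (mix \<alpha> \<mu> \<nu>) h = \<alpha> * sint S \<mu> h + (1 - \<alpha>) * sint S \<nu> h"
proof -
  obtain M N where M: "prob_on S M" "\<mu> = set_fun M" and N: "prob_on S N" "\<nu> = set_fun N"
    using assms by (auto simp: pmeasures_iff)
  have "- S \<in> sets borel"
    using S by (simp add: compact_imp_closed borel_open open_Compl)
  then obtain L where L: "prob_on S L" "set_fun L = mix \<alpha> \<mu> \<nu>"
    using prob_on_mix[OF M(1) N(1) \<alpha>] M N by metis
  obtain B where "\<And>x. \<bar>cutoff S h x\<bar> \<le> B" using cutoff_bounded S by metis
  then have "integral\<^sup>L L (cutoff S h) = \<alpha> * integral\<^sup>L M (cutoff S h) + (1 - \<alpha>) * integral\<^sup>L N (cutoff S h)"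
  proof (rule integral_lincomb[rotated -1])
    show "measure L A = \<alpha> * measure M A + (1 - \<alpha>) * measure N A" if "A \<in> sets M" for A
      using fun_cong[OF L(2), of A] that M N L by (simp add: set_fun_def mix_def prob_on_def)
  qed (use M N L \<alpha> borel_measurable_cutoff[OF S] in
        \<open>auto simp: prob_on_def prob_space_def cong: measurable_cong_sets\<close>)
  then show ?thesis
    using sint_set_fun[OF S] M N L by metis
qed

lemma pmeasures_subset_smeasures: "pmeasures S \<subseteq> smeasures S"
proof
  fix \<pi> assume "\<pi> \<in> pmeasures S"
  then obtain M where M: "prob_on S M" "\<pi> = set_fun M" by (auto simp: pmeasures_iff)
  then have "finite_measure M" by (simp add: prob_on_def prob_space_def)
  moreover have "finite_measure (null_measure borel)" by (rule finite_measureI) simp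
  ultimately show "\<pi> \<in> smeasures S"
    unfolding smeasures_def using M
    by (intro CollectI exI[of _ M] exI[of _ "null_measure borel"])
      (auto simp: prob_on_def set_fun_def measure_def)
qed

section \<open>Push-forwards and marginals\<close>

lemma prob_on_distr:
  assumes M: "prob_on S M" and f: "f \<in> borel_measurable borel" "f ` S \<subseteq> T" and "- T \<in> sets borel"
    and "- S \<in> sets borel"
  shows "prob_on T (distr M borel f)"
proof -
  interpret prob_space M using M by (simp add: prob_on_def)
  have [measurable]: "f \<in> borel_measurable M"
    using f M by (auto simp: prob_on_def cong: measurable_cong_sets)
  have "emeasure M (f -` (- T) \<inter> space M) \<le> emeasure M (- S)"
    using f assms by (intro emeasure_mono) (auto simp: prob_on_def)
  then show ?thesis
    using M assms by (auto simp: prob_on_def emeasure_distr intro: prob_space_distr)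
qed

lemma AE_prob_on: "prob_on S M \<Longrightarrow> - S \<in> sets borel \<Longrightarrow> AE x in M. x \<in> S"
  by (rule AE_I[of _ _ "- S"]) (auto simp: prob_on_def)

text \<open>The two integrands may differ outside \<open>S\<close>, where \<open>f x\<close> can
  still lie in \<open>T\<close>; but \<open>M\<close> does not charge the complement of
  \<open>S\<close>.\<close>

lemma integral_distr_cutoff:
  fixes T :: "'b::t2_space set"
  assumes M: "prob_on S M" "- S \<in> sets borel" and f: "f \<in> borel_measurable borel" "f ` S \<subseteq> T"
    and T: "compact T" "continuous_on T h"
  shows "integral\<^sup>L (distr M borel f) (cutoff T h) = integral\<^sup>L M (cutoff S (h \<circ> f))"
proof -
  have [measurable]: "f \<in> borel_measurable M" "cutoff T h \<in> borel_measurable borel"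
    using f M borel_measurable_cutoff[OF T] by (auto simp: prob_on_def cong: measurable_cong_sets)
  have meas: "(\<lambda>x. cutoff T h (f x)) \<in> borel_measurable M" by measurable
  have "S \<in> sets M"
    using sets.compl_sets[OF M(2)] M(1) by (simp add: prob_on_def Compl_eq_Diff_UNIV[symmetric])
  then have "(\<lambda>x. if x \<in> S then cutoff T h (f x) else 0) \<in> borel_measurable M"
    using meas by measurable
  also have "(\<lambda>x. if x \<in> S then cutoff T h (f x) else 0) = cutoff S (h \<circ> f)"
    using f(2) by (auto simp: cutoff_def fun_eq_iff)
  finally have "integral\<^sup>L M (\<lambda>x. cutoff T h (f x)) = integral\<^sup>L M (cutoff S (h \<circ> f))"
    using AE_prob_on[OF M] f(2) meas by (intro integral_cong_AE) (auto simp: cutoff_def)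
  then show ?thesis by (simp add: integral_distr)
qed

lemma marg_set_fun:
  fixes M :: "('a::second_countable_topology \<times> 'b::second_countable_topology) measure"
  assumes "sets M = sets borel"
  shows "fst_marg (set_fun M) = set_fun (distr M borel fst)"
    and "snd_marg (set_fun M) = set_fun (distr M borel snd)"
proof -
  have sp: "space M = UNIV" using sets_eq_imp_space_eq[OF assms] by simp
  have [measurable]: "fst \<in> borel_measurable M" "snd \<in> borel_measurable M"
    using assms by (auto simp: borel_prod[symmetric] cong: measurable_cong_sets)
  have *: "fst -` A \<inter> space M = A \<times> UNIV" "snd -` B \<inter> space M = UNIV \<times> B" for A B
    by (auto simp: sp)
  have "A \<times> (UNIV :: 'b set) \<in> sets borel" if "A \<in> sets borel" for A :: "'a set"
    using measurable_sets[OF _ that, of fst M] assms by (simp add: *)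
  then show "fst_marg (set_fun M) = set_fun (distr M borel fst)"
    using assms by (auto simp: fst_marg_def set_fun_def measure_distr * fun_eq_iff)
  have "(UNIV :: 'a set) \<times> A \<in> sets borel" if "A \<in> sets borel" for A :: "'b set"
    using measurable_sets[OF _ that, of snd M] assms by (simp add: *)
  then show "snd_marg (set_fun M) = set_fun (distr M borel snd)"
    using assms by (auto simp: snd_marg_def set_fun_def measure_distr * fun_eq_iff)
qed

section \<open>Sequential compactness\<close>

text \<open>A Cantor-type code: the memberships of \<open>x\<close> in the sets \<open>B k\<close>
  are the base-3 digits 0 or 1 of \<open>s x\<close>. All digits after position \<open>k\<close>
  together contribute at most \<open>1 / (2 * 3 ^ k)\<close>, half the weight
  \<open>1 / 3 ^ k\<close> of digit \<open>k\<close>, so a small difference of codes forces the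
  leading digits to agree. The bound \<open>3 / 2\<close> is the code with all digits 1.\<close>

lemma separating_real_injection:
  fixes B :: "nat \<Rightarrow> 'b set" and s :: "'b \<Rightarrow> real"
  defines "s \<equiv> \<lambda>x. \<Sum>k. indicator (B k) x / 3 ^ k"
  shows "0 \<le> s x" "s x \<le> 3 / 2"
    and "\<bar>s x - s y\<bar> < 1 / (2 * 3 ^ n) \<Longrightarrow> k \<le> n \<Longrightarrow> x \<in> B k \<longleftrightarrow> y \<in> B k"
proof -
  define b where "b = (\<lambda>x k. indicator (B k) x / 3 ^ k :: real)"
  have geo: "(\<lambda>k. 1 / 3 ^ k :: real) sums (3 / 2)"
    using geometric_sums[of "1 / 3 :: real"] by (simp add: power_divide)
  have b: "0 \<le> b x k" "b x k \<le> 1 / 3 ^ k" for x k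
    by (auto simp: b_def indicator_def)
  have summ: "summable (b x)" for x
    using b by (intro summable_comparison_test'[OF sums_summable[OF geo]]) auto
  have s: "s x = suminf (b x)" for x by (simp add: s_def b_def)
  show "0 \<le> s x" "s x \<le> 3 / 2"
    using suminf_nonneg[OF summ b(1), of x] suminf_le[OF b(2) summ sums_summable[OF geo], of x]
    unfolding s sums_unique[OF geo, symmetric] by auto
  \<comment> \<open>Strong induction makes the digits before \<open>k\<close> cancel. What is left
    is digit \<open>k\<close> plus a tail, and the hypothesis together with the tail bound puts the
    digit difference strictly below \<open>1 / 3 ^ k\<close>, hence at 0.\<close>
  show "x \<in> B k \<longleftrightarrow> y \<in> B k" if lt: "\<bar>s x - s y\<bar> < 1 / (2 * 3 ^ n)" and "k \<le> n"
    using \<open>k \<le> n\<close>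
  proof (induction k rule: less_induct)
    case (less k)
    define d where "d = (\<lambda>j. b x j - b y j)"
    have sd: "summable d" unfolding d_def using summ by (intro summable_diff)
    have "s x - s y = suminf d"
      unfolding s d_def by (rule suminf_diff[OF summ summ])
    also have "\<dots> = (\<Sum>j. d (j + Suc k)) + (\<Sum>j<Suc k. d j)"
      using sd by (rule suminf_split_initial_segment)
    also have "(\<Sum>j<Suc k. d j) = d k"
      using less by (simp add: d_def b_def indicator_def)
    finally have eq: "s x - s y = (\<Sum>j. d (j + Suc k)) + d k" .
    have geo': "(\<lambda>j. 1 / 3 ^ (j + Suc k) :: real) sums (1 / (2 * 3 ^ k))"
      using sums_mult[OF geo, of "1 / 3 ^ Suc k"] by (simp add: power_add field_simps)
    have d: "\<bar>d j\<bar> \<le> 1 / 3 ^ j" for j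
      by (auto simp: d_def b_def indicator_def)
    have "\<bar>\<Sum>j. d (j + Suc k)\<bar> \<le> (\<Sum>j. 1 / 3 ^ (j + Suc k))"
    proof -
      have ab: "summable (\<lambda>j. \<bar>d (j + Suc k)\<bar>)"
        using d[of "_ + Suc k"] by (intro summable_comparison_test'[OF sums_summable[OF geo'], of 0]) simp
      have "\<bar>\<Sum>j. d (j + Suc k)\<bar> \<le> (\<Sum>j. \<bar>d (j + Suc k)\<bar>)"
        using ab by (rule summable_rabs)
      also have "\<dots> \<le> (\<Sum>j. 1 / 3 ^ (j + Suc k))"
        by (rule suminf_le[OF d ab sums_summable[OF geo']])
      finally show ?thesis .
    qed
    then have tail: "\<bar>\<Sum>j. d (j + Suc k)\<bar> \<le> 1 / (2 * 3 ^ k)"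
      using geo' by (simp add: sums_iff)
    have "1 / (2 * 3 ^ n) \<le> 1 / (2 * 3 ^ k :: real)"
      using less.prems by (intro divide_left_mono) (auto intro: power_increasing)
    then have "\<bar>d k\<bar> < 1 / (2 * 3 ^ k) + 1 / (2 * 3 ^ k)"
      using tail eq lt by linarith
    then have "\<bar>d k\<bar> < 1 / 3 ^ k" by simp
    then show ?case
      by (cases "x \<in> B k"; cases "y \<in> B k") (auto simp: d_def b_def)
  qed
qed

text \<open>Compactness is transported from the real line: a Borel injection into the line with uniformly
  continuous inverse reduces it to Helly's selection theorem, and the inverse, extended to the closure
  of its domain, carries the limit measure back.\<close>

theorem prob_on_compact_seq:
  fixes S :: "'b::{complete_space,second_countable_topology} set"
  assumes S: "compact S" and M: "\<And>n. prob_on S (M n)"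
  obtains r N where "strict_mono (r :: nat \<Rightarrow> nat)" "prob_on S N"
    "\<And>h. continuous_on S h \<Longrightarrow> (\<lambda>n. integral\<^sup>L (M (r n)) (cutoff S h)) \<longlonglongrightarrow> integral\<^sup>L N (cutoff S h)"
proof -
  have cS: "- S \<in> sets borel"
    using S by (simp add: compact_imp_closed borel_open open_Compl)
  obtain \<B> :: "'b set set" where \<B>: "countable \<B>" "topological_basis \<B>"
    using ex_countable_basis by blast
  have "\<B> \<noteq> {}"
  proof
    assume "\<B> = {}"
    with \<B>(2) have "\<not> open (UNIV :: 'b set)"
      using topological_basisE[of \<B> UNIV undefined] by auto
    then show False by simp
  qed
  define B where "B = from_nat_into \<B>"
  have rB: "range B = \<B>"
    using \<open>\<B> \<noteq> {}\<close> \<B>(1) by (simp add: B_def range_from_nat_into)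
  have oB [measurable]: "B k \<in> sets borel" for k
    using rB topological_basis_open[OF \<B>(2)] by (intro borel_open) auto
  define s :: "'b \<Rightarrow> real" where "s x = (\<Sum>k. indicator (B k) x / 3 ^ k)" for x
  have [measurable]: "s \<in> borel_measurable borel"
    unfolding s_def[abs_def] by measurable
  note s = separating_real_injection[of B, folded s_def]

  \<comment> \<open>Finitely many basic sets of small diameter cover \<open>S\<close>. If
    \<open>n\<close> bounds their indices, agreement of the digits up to \<open>n\<close> puts
    \<open>y\<close> into the same small set as \<open>x\<close>.\<close>
  have sep: "\<exists>\<delta>>0. \<forall>x\<in>S. \<forall>y\<in>S. \<bar>s x - s y\<bar> < \<delta> \<longrightarrow> dist x y < e" if "e > 0" for e
  proof -
    define I where "I = {k. \<exists>z. B k \<subseteq> ball z (e / 2)}"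
    have "S \<subseteq> (\<Union>k\<in>I. B k)"
    proof
      fix x
      obtain U where "U \<in> \<B>" "x \<in> U" "U \<subseteq> ball x (e / 2)"
        using topological_basisE[OF \<B>(2), of "ball x (e / 2)" x] \<open>e > 0\<close> by auto
      then show "x \<in> (\<Union>k\<in>I. B k)"
        using rB by (auto simp: I_def)
    qed
    moreover have "open (B k)" for k
      using rB topological_basis_open[OF \<B>(2)] by auto
    ultimately obtain J where J: "J \<subseteq> I" "finite J" "S \<subseteq> (\<Union>k\<in>J. B k)"
      using compactE_image[OF S, of I B] by metis
    obtain n where n: "\<And>k. k \<in> J \<Longrightarrow> k \<le> n"
      using \<open>finite J\<close> by (auto simp: finite_nat_set_iff_bounded_le)
    have "dist x y < e" if xy: "x \<in> S" "y \<in> S" "\<bar>s x - s y\<bar> < 1 / (2 * 3 ^ n)" for x y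
    proof -
      obtain k where k: "k \<in> J" "x \<in> B k" using J(3) xy(1) by blast
      then have "y \<in> B k" using s(3)[OF xy(3) n[OF k(1)]] by simp
      moreover obtain z where "B k \<subseteq> ball z (e / 2)" using k J by (auto simp: I_def)
      ultimately have "dist z x < e / 2" "dist z y < e / 2" using k by auto
      then show ?thesis by (rule dist_triangle_half_r)
    qed
    then show ?thesis by (intro exI[of _ "1 / (2 * 3 ^ n)"]) auto
  qed
  have inj: "inj_on s S"
  proof (rule inj_onI, rule ccontr)
    fix x y assume "x \<in> S" "y \<in> S" "s x = s y" "x \<noteq> y"
    then have "dist x y < dist x y" using sep[of "dist x y"] by fastforce
    then show False by simp
  qed
  have "uniformly_continuous_on (s ` S) (inv_into S s)"
    unfolding uniformly_continuous_on_def
  proof (intro allI impI)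
    fix e :: real assume "e > 0"
    from sep[OF this] obtain \<delta> where "\<delta> > 0"
      and \<delta>: "\<And>x y. x \<in> S \<Longrightarrow> y \<in> S \<Longrightarrow> \<bar>s x - s y\<bar> < \<delta> \<Longrightarrow> dist x y < e" by blast
    then show "\<exists>\<delta>>0. \<forall>a\<in>s ` S. \<forall>b\<in>s ` S. dist b a < \<delta> \<longrightarrow>
        dist (inv_into S s b) (inv_into S s a) < e"
      using inj by (intro exI[of _ \<delta>]) (auto simp: dist_real_def)
  qed
  then obtain \<phi> where uc: "uniformly_continuous_on (closure (s ` S)) \<phi>"
    and \<phi>: "\<And>x. x \<in> s ` S \<Longrightarrow> inv_into S s x = \<phi> x"
    by (rule uniformly_continuous_on_extension_on_closure) (rule that)
  define C where "C = closure (s ` S)"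
  have cont: "continuous_on C \<phi>"
    using uc by (simp add: C_def uniformly_continuous_imp_continuous)
  have \<phi>s: "\<phi> (s x) = x" if "x \<in> S" for x
    using \<phi>[of "s x"] that inj by simp
  have \<phi>C: "\<phi> x \<in> S" if "x \<in> C" for x
  proof -
    have "\<phi> ` s ` S \<subseteq> S" using \<phi>s by auto
    then have "\<phi> ` C \<subseteq> S"
      using image_closure_subset[of "s ` S" \<phi> S] cont S by (simp add: C_def compact_imp_closed)
    then show ?thesis using that by auto
  qed
  have sC: "s x \<in> C" if "x \<in> S" for x
    using that closure_subset[of "s ` S"] by (auto simp: C_def)
  have [measurable]: "C \<in> sets borel" and "closed C" by (auto simp: C_def borel_closed)

  have "S \<noteq> {}"
  proof
    assume "S = {}"
    then have "emeasure (M 0) (space (M 0)) = 0"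
      using M[of 0] sets_eq_imp_space_eq[of "M 0" borel] by (simp add: prob_on_def)
    then show False using M[of 0] by (simp add: prob_on_def prob_space.emeasure_space_1)
  qed
  then obtain x0 where x0: "x0 \<in> S" by auto
  have "C \<noteq> {}" using x0 sC by auto

  define \<nu> where "\<nu> n = distr (M n) borel s" for n
  have sM [measurable]: "s \<in> borel_measurable (M n)" for n
    using M[of n] by (simp add: prob_on_def cong: measurable_cong_sets)
  have rd: "real_distribution (\<nu> n)" for n
    using M[of n] prob_space.prob_space_distr[of "M n" s borel]
    by (auto simp: real_distribution_def real_distribution_axioms_def \<nu>_def prob_on_def)
  \<comment> \<open>All codes lie between 0 and \<open>3 / 2\<close>, so one fixed interval carries
    the full mass of every \<open>\<nu> n\<close>.\<close>
  have "tight \<nu>"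
    unfolding tight_def
  proof (intro conjI allI impI rd)
    fix e :: real assume "e > 0"
    have "measure (\<nu> n) {-1<..2} = 1" for n
    proof -
      have "-1 < s x" "s x \<le> 2" for x using s(1,2)[of x] by linarith+
      then have "s -` {-1<..2} \<inter> space (M n) = space (M n)" by auto
      then show ?thesis
        using M[of n] by (simp add: \<nu>_def measure_distr prob_on_def prob_space.prob_space)
    qed
    then show "\<exists>a b. a < b \<and> (\<forall>n. 1 - e < measure (\<nu> n) {a<..b})"
      using \<open>e > 0\<close> by (intro exI[of _ "-1"] exI[of _ 2]) auto
  qed
  then obtain r L where r: "strict_mono (r :: nat \<Rightarrow> nat)" and L: "real_distribution L"
    and w: "weak_conv_m (\<nu> \<circ> id \<circ> r) L"
    using tight_imp_convergent_subsubsequence[of \<nu> id] by (auto simp: strict_mono_def)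
  interpret L: real_distribution L by fact
  have lim: "(\<lambda>n. integral\<^sup>L (M (r n)) (\<lambda>x. f (s x))) \<longlonglongrightarrow> integral\<^sup>L L f"
    if f: "continuous_on UNIV f" "\<And>x. norm (f x) \<le> K" for f :: "real \<Rightarrow> real" and K
  proof -
    have "(\<lambda>n. integral\<^sup>L (\<nu> (r n)) f) \<longlonglongrightarrow> integral\<^sup>L L f"
      using weak_conv_imp_integral_bdd_continuous_conv[OF _ L w[unfolded comp_def id_def], of f K] f rd
      by (simp add: continuous_on_eq_continuous_at)
    moreover have "f \<in> borel_measurable borel"
      using f by (simp add: borel_measurable_continuous_onI)
    ultimately show ?thesis by (simp add: \<nu>_def integral_distr)
  qed

  \<comment> \<open>The truncated distance to \<open>C\<close> is a bounded continuous test function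
    that vanishes exactly on the closed set \<open>C\<close>. Its integrals along the sequence are
    0, hence so is the one against \<open>L\<close>.\<close>
  have "AE x in L. x \<in> C"
  proof -
    define f where "f x = min 1 (infdist x C)" for x
    have f: "continuous_on UNIV f" "norm (f x) \<le> 1" "0 \<le> f x" for x
      unfolding f_def by (auto intro!: continuous_intros simp: infdist_nonneg)
    have [measurable]: "f \<in> borel_measurable borel"
      using f by (simp add: borel_measurable_continuous_onI)
    have "integral\<^sup>L (M n) (\<lambda>x. f (s x)) = 0" for n
    proof -
      have "AE x in M n. f (s x) = 0"
        using AE_prob_on[OF M[of n] cS] by eventually_elim (auto simp: f_def sC)
      then show ?thesis by (simp add: integral_eq_zero_AE)
    qed
    with lim[OF f(1,2)] have "integral\<^sup>L L f = 0"
      by (simp add: LIMSEQ_const_iff)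
    then have "AE x in L. f x = 0"
      using f by (subst (asm) integral_nonneg_eq_0_iff_AE) (auto intro!: L.integrable_const_bound[where B=1])
    then show ?thesis
      by eventually_elim
        (use \<open>closed C\<close> \<open>C \<noteq> {}\<close> in \<open>auto simp: f_def min_def in_closed_iff_infdist_zero split: if_splits\<close>)
  qed
  moreover have "- C \<in> sets borel" by measurable
  ultimately have "prob_on C L"
    using L.prob_space_axioms AE_iff_measurable[of "- C" L "\<lambda>x. x \<in> C"] by (auto simp: prob_on_def)
  \<comment> \<open>The value \<open>x0\<close> off \<open>C\<close> is arbitrary; it only makes the
    map total and Borel with values in \<open>S\<close>, and \<open>L\<close> does not charge that
    region.\<close>
  define \<psi> where "\<psi> x = (if x \<in> C then \<phi> x else x0)" for x
  have \<psi>: "\<psi> \<in> borel_measurable borel" "\<psi> ` C \<subseteq> S"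
    unfolding \<psi>_def using cont \<phi>C by (auto intro!: borel_measurable_continuous_on_if)
  define N where "N = distr L borel \<psi>"
  have "prob_on S N"
    unfolding N_def using prob_on_distr[OF \<open>prob_on C L\<close> \<psi> cS \<open>- C \<in> sets borel\<close>] .
  moreover have "(\<lambda>n. integral\<^sup>L (M (r n)) (cutoff S h)) \<longlonglongrightarrow> integral\<^sup>L N (cutoff S h)"
    if h: "continuous_on S h" for h
  proof -
    obtain K where K: "0 \<le> K" "\<And>x. \<bar>cutoff S h x\<bar> \<le> K"
      using cutoff_bounded[OF S h] by metis
    \<comment> \<open>Weak convergence on the line needs test functions that are continuous and
      bounded everywhere. Tietze extends \<open>h \<circ> \<phi>\<close> from the closed set
      \<open>C\<close> with the same bound, and on \<open>C\<close>, which carries all the measures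
      involved, nothing changes.\<close>
    have "continuous_on C (h \<circ> \<phi>)"
      using cont h \<phi>C by (intro continuous_on_compose) (auto intro: continuous_on_subset)
    moreover have "norm ((h \<circ> \<phi>) x) \<le> K" if "x \<in> C" for x
      using K(2)[of "\<phi> x"] \<phi>C[OF that] by (simp add: cutoff_def)
    ultimately obtain g where g: "continuous_on UNIV g" "\<And>x. x \<in> C \<Longrightarrow> g x = (h \<circ> \<phi>) x"
      "\<And>x. norm (g x) \<le> K"
      using Tietze[of C "h \<circ> \<phi>" UNIV K] \<open>closed C\<close> K(1) by auto
    have [measurable]: "g \<in> borel_measurable borel"
      using g by (simp add: borel_measurable_continuous_onI)
    have [measurable]: "cutoff S h \<in> borel_measurable (M n)" for n
      using borel_measurable_cutoff[OF S h] M[of n] by (simp add: prob_on_def cong: measurable_cong_sets)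
    have "integral\<^sup>L (M n) (\<lambda>x. g (s x)) = integral\<^sup>L (M n) (cutoff S h)" for n
    proof (rule integral_cong_AE)
      show "AE x in M n. g (s x) = cutoff S h x"
        using AE_prob_on[OF M[of n] cS] by eventually_elim (simp add: cutoff_def g(2) sC \<phi>s)
    qed measurable
    moreover have "integral\<^sup>L L g = integral\<^sup>L N (cutoff S h)"
    proof -
      have [measurable]: "\<psi> \<in> borel_measurable borel" "cutoff S h \<in> borel_measurable borel"
        using \<psi> borel_measurable_cutoff[OF S h] by auto
      have "integral\<^sup>L N (cutoff S h) = integral\<^sup>L L (\<lambda>x. cutoff S h (\<psi> x))"
        by (simp add: N_def integral_distr)
      also have "\<dots> = integral\<^sup>L L g"
      proof (rule integral_cong_AE)
        show "AE x in L. cutoff S h (\<psi> x) = g x"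
          using \<open>AE x in L. x \<in> C\<close> by eventually_elim (simp add: cutoff_def g(2) \<psi>_def \<phi>C)
      qed measurable
      finally show ?thesis by simp
    qed
    ultimately show ?thesis using lim[OF g(1,3)] by simp
  qed
  ultimately show ?thesis using r that by blast
qed

text \<open>The finite intersections of a countable basis form a countable intersection-stable
  generator of the Borel sets, so a probability measure is determined by its values there. Each of
  these sets is open, and its indicator is the pointwise limit of the truncated multiples
  \<open>min 1 (n * infdist x (- U))\<close>; dominated convergence recovers its measure from the
  integrals.\<close>

lemma countable_determining_functions:
  obtains w :: "nat \<Rightarrow> 'b::{metric_space,second_countable_topology} \<Rightarrow> real"
  where "\<And>k. continuous_on UNIV (w k)"
    "\<And>S M N. compact S \<Longrightarrow> prob_on S M \<Longrightarrow> prob_on S N \<Longrightarrow>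
      (\<And>k. integral\<^sup>L M (cutoff S (w k)) = integral\<^sup>L N (cutoff S (w k))) \<Longrightarrow> M = N"
proof -
  obtain \<B> :: "'b set set" where \<B>: "countable \<B>" "topological_basis \<B>"
    using ex_countable_basis by blast
  define E where "E = {\<Inter>A |A. finite A \<and> A \<subseteq> \<B>}"
  have "E = Inter ` {A. finite A \<and> A \<subseteq> \<B>}" by (auto simp: E_def)
  then have cE: "countable E"
    using countable_Collect_finite_subset[OF \<B>(1)] by simp
  have UE: "UNIV \<in> E" unfolding E_def by (auto intro!: exI[of _ "{}"])
  have BE: "\<B> \<subseteq> E" unfolding E_def by (auto intro!: exI[of _ "{_}"])
  have oE: "open U" if "U \<in> E" for U
    using that topological_basis_open[OF \<B>(2)] by (auto simp: E_def intro!: open_Inter)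
  have "Int_stable E"
  proof (rule Int_stableI)
    fix U V assume "U \<in> E" "V \<in> E"
    then obtain A A' where "U = \<Inter>A" "V = \<Inter>A'" "finite A" "finite A'" "A \<subseteq> \<B>" "A' \<subseteq> \<B>"
      by (auto simp: E_def)
    then show "U \<inter> V \<in> E"
      unfolding E_def by (intro CollectI exI[of _ "A \<union> A'"]) auto
  qed
  have tbE: "topological_basis E"
  proof (rule topological_basisI)
    fix O' :: "'b set" and x assume "open O'" "x \<in> O'"
    then obtain U where "U \<in> \<B>" "x \<in> U" "U \<subseteq> O'"
      by (rule topological_basisE[OF \<B>(2)])
    then show "\<exists>U\<in>E. x \<in> U \<and> U \<subseteq> O'" using BE by auto
  qed (rule oE)
  then have borelE: "sets borel = sigma_sets UNIV E"
    using borel_eq_countable_basis[OF cE] by (metis Pow_UNIV sets_measure_of subset_UNIV)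
  \<comment> \<open>\<open>infdist\<close> to the empty set is 0 by convention, so the whole space
    needs a separate clause.\<close>
  define f where "f U n x = (if U = UNIV then 1 else min 1 (real n * infdist x (- U)))" for U :: "'b set" and n x
  have fc: "continuous_on UNIV (f U n)" for U n
    unfolding f_def by (cases "U = UNIV") (auto intro!: continuous_intros)
  have flim: "(\<lambda>n. f U n x) \<longlonglongrightarrow> indicator U x" if "open U" for U x
  proof (cases "x \<in> U \<and> U \<noteq> UNIV")
    case True
    then have "infdist x (- U) > 0"
      using that in_closed_iff_infdist_zero[of "- U" x] infdist_nonneg[of x "- U"]
      by (auto simp: less_le)
    then obtain n0 :: nat where n0: "1 < real n0 * infdist x (- U)"
      using reals_Archimedean3 by blast
    have "f U n x = 1" if "n \<ge> n0" for n
    proof -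
      have "real n0 * infdist x (- U) \<le> real n * infdist x (- U)"
        using that by (intro mult_right_mono) (auto simp: infdist_nonneg)
      then show ?thesis using n0 by (simp add: f_def)
    qed
    then show ?thesis
      using True by (intro tendsto_eventually) (auto simp: eventually_sequentially)
  next
    case False
    then have "f U n x = indicator U x" for n by (auto simp: f_def)
    then show ?thesis by simp
  qed
  have fb: "\<bar>f U n x\<bar> \<le> 1" for U n x
    by (auto simp: f_def infdist_nonneg)
  define G where "G = (\<lambda>(U, n). f U n) ` (E \<times> (UNIV :: nat set))"
  have G: "countable G" "G \<noteq> {}"
    using cE UE by (auto simp: G_def)
  define w where "w = from_nat_into G"
  have rw: "range w = G" using G by (simp add: w_def range_from_nat_into)
  show ?thesis
  proof (rule that[of w])
    fix k
    have "w k \<in> G" using rw by auto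
    then show "continuous_on UNIV (w k)" by (auto simp: G_def fc)
  next
    fix S :: "'b set" and M N
    assume S: "compact S" and M: "prob_on S M" and N: "prob_on S N"
      and eq: "\<And>k. integral\<^sup>L M (cutoff S (w k)) = integral\<^sup>L N (cutoff S (w k))"
    have cS: "- S \<in> sets borel"
      using S by (simp add: compact_imp_closed borel_open open_Compl)
    have lim: "(\<lambda>n. integral\<^sup>L L (cutoff S (f U n))) \<longlonglongrightarrow> measure L U"
      if L: "prob_on S L" and "U \<in> E" for L U
    proof -
      interpret L: prob_space L using L by (simp add: prob_on_def)
      have [measurable_cong]: "sets L = sets borel" using L by (simp add: prob_on_def)
      have [measurable]: "U \<in> sets borel" using oE[OF that(2)] by simp
      have [measurable]: "cutoff S (f U n) \<in> borel_measurable borel" for n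
        using borel_measurable_cutoff[OF S continuous_on_subset[OF fc]] by simp
      have "(\<lambda>n. integral\<^sup>L L (cutoff S (f U n))) \<longlonglongrightarrow> integral\<^sup>L L (indicator U)"
      proof (rule integral_dominated_convergence[where w="\<lambda>_. 1"])
        show "AE x in L. (\<lambda>n. cutoff S (f U n) x) \<longlonglongrightarrow> indicator U x"
          using AE_prob_on[OF L cS]
          by eventually_elim (auto simp: cutoff_def flim oE[OF that(2)])
        show "AE x in L. norm (cutoff S (f U n) x) \<le> 1" for n
          by (auto simp: cutoff_def fb)
      qed auto
      then show ?thesis by simp
    qed
    have "measure M U = measure N U" if "U \<in> E" for U
    proof -
      have "integral\<^sup>L M (cutoff S (f U n)) = integral\<^sup>L N (cutoff S (f U n))" for n
      proof -
        have "f U n \<in> range w" using that by (auto simp: rw G_def)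
        then show ?thesis using eq by auto
      qed
      then show ?thesis
        using LIMSEQ_unique[OF lim[OF M that]] lim[OF N that] by simp
    qed
    then have "emeasure M U = emeasure N U" if "U \<in> E" for U
      using that M N by (simp add: prob_on_def finite_measure.emeasure_eq_measure prob_space_def)
    then show "M = N"
      using M N UE \<open>Int_stable E\<close> borelE
      by (intro measure_eqI_generator_eq[of E UNIV M N "\<lambda>_. UNIV"])
        (auto simp: prob_on_def finite_measure.emeasure_eq_measure prob_space_def)
  qed
qed

section \<open>A finite minimax lemma\<close>

text \<open>The weights are the normalized normal of a line in the plane that separates the points
  with both coordinates below \<open>t\<close> from the points dominating some
  \<open>(f x, g x)\<close>. Convexity enters only as the existence of a point dominated by the
  mixture (Fan's convexlike condition), so \<open>'c\<close> needs no linear structure.\<close>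

lemma two_function_minimax:
  fixes f g :: "'c \<Rightarrow> real"
  assumes conv: "\<And>x y a. x \<in> C \<Longrightarrow> y \<in> C \<Longrightarrow> 0 \<le> a \<Longrightarrow> a \<le> 1 \<Longrightarrow>
      \<exists>z\<in>C. f z \<le> a * f x + (1 - a) * f y \<and> g z \<le> a * g x + (1 - a) * g y"
    and max: "\<And>x. x \<in> C \<Longrightarrow> t \<le> f x \<or> t \<le> g x"
  obtains l where "0 \<le> l" "l \<le> 1" "\<And>x. x \<in> C \<Longrightarrow> t \<le> l * f x + (1 - l) * g x"
proof (cases "C = {}")
  case True
  then show ?thesis using that[of 0] by simp
next
  case False
  define S where "S = {..<t} \<times> {..<t}"
  \<comment> \<open>The image of \<open>C\<close> under \<open>(f, g)\<close> need not be convex;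
    its upward closure is, by \<open>conv\<close>.\<close>
  define T where "T = {(p, q). \<exists>x\<in>C. f x \<le> p \<and> g x \<le> q}"
  have "convex S" unfolding S_def by (intro convex_Times) auto
  moreover have "convex T"
  proof (rule convexI)
    fix z z' and u v :: real
    assume "z \<in> T" "z' \<in> T" and uv: "0 \<le> u" "0 \<le> v" "u + v = 1"
    then obtain x y where x: "x \<in> C" "f x \<le> fst z" "g x \<le> snd z"
      and y: "y \<in> C" "f y \<le> fst z'" "g y \<le> snd z'" by (auto simp: T_def)
    have "v = 1 - u" using uv by simp
    obtain w where w: "w \<in> C" "f w \<le> u * f x + v * f y" "g w \<le> u * g x + v * g y"
      using conv[OF x(1) y(1), of u] uv by (auto simp: \<open>v = 1 - u\<close>)
    have "u * f x + v * f y \<le> u * fst z + v * fst z'" "u * g x + v * g y \<le> u * snd z + v * snd z'"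
      using x y uv by (auto intro!: add_mono mult_left_mono)
    with w show "u *\<^sub>R z + v *\<^sub>R z' \<in> T"
      by (auto simp: T_def case_prod_beta intro!: bexI[of _ w])
  qed
  moreover have "S \<noteq> {}" by (auto simp: S_def intro!: exI[of _ "t - 1"])
  moreover have "T \<noteq> {}"
  proof -
    obtain x where "x \<in> C" using False by auto
    then have "(f x, g x) \<in> T" by (auto simp: T_def)
    then show ?thesis by auto
  qed
  moreover have "S \<inter> T = {}" using max by (force simp: S_def T_def)
  ultimately obtain c b where c: "c \<noteq> 0" and below: "\<And>z. z \<in> S \<Longrightarrow> inner c z \<le> b"
    and above: "\<And>z. z \<in> T \<Longrightarrow> b \<le> inner c z"
    using separating_hyperplane_sets[of S T] by metis
  obtain p q where pq: "c = (p, q)" by (cases c)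
  obtain x where x: "x \<in> C" using False by auto
  \<comment> \<open>The set above the graph is upward closed, so the separating functional is nonnegative.\<close>
  have "0 \<le> p"
  proof (rule ccontr)
    assume "\<not> 0 \<le> p"
    define s where "s = (\<bar>b - p * f x - q * g x\<bar> + 1) / (- p)"
    have "0 \<le> s" and "p * s = - \<bar>b - p * f x - q * g x\<bar> - 1"
      using \<open>\<not> 0 \<le> p\<close> by (auto simp: s_def field_simps)
    moreover have "(f x + s, g x) \<in> T" using x \<open>0 \<le> s\<close> by (auto simp: T_def intro!: bexI[of _ x])
    ultimately show False using above[of "(f x + s, g x)"] by (auto simp: pq algebra_simps)
  qed
  have "0 \<le> q"
  proof (rule ccontr)
    assume "\<not> 0 \<le> q"
    define s where "s = (\<bar>b - p * f x - q * g x\<bar> + 1) / (- q)"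
    have "0 \<le> s" and "q * s = - \<bar>b - p * f x - q * g x\<bar> - 1"
      using \<open>\<not> 0 \<le> q\<close> by (auto simp: s_def field_simps)
    moreover have "(f x, g x + s) \<in> T" using x \<open>0 \<le> s\<close> by (auto simp: T_def intro!: bexI[of _ x])
    ultimately show False using above[of "(f x, g x + s)"] by (auto simp: pq algebra_simps)
  qed
  have "p + q > 0" using c \<open>0 \<le> p\<close> \<open>0 \<le> q\<close> pq by (auto simp: zero_prod_def)
  \<comment> \<open>The corner \<open>(t, t)\<close> is not in the open quadrant \<open>S\<close>,
    so it is approached along the diagonal; the offset \<open>e / (p + q)\<close> costs exactly
    \<open>e\<close>.\<close>
  have "(p + q) * t \<le> b"
  proof (rule field_le_epsilon)
    fix e :: real assume "e > 0"
    then have "(t - e / (p + q), t - e / (p + q)) \<in> S"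
      using \<open>p + q > 0\<close> by (auto simp: S_def)
    from below[OF this] have "(p + q) * (t - e / (p + q)) \<le> b"
      by (simp only: pq inner_Pair inner_real_def distrib_right)
    moreover have "(p + q) * (t - e / (p + q)) = (p + q) * t - e"
      using \<open>p + q > 0\<close> by (simp add: right_diff_distrib)
    ultimately show "(p + q) * t \<le> b + e" by linarith
  qed
  show ?thesis
  proof (rule that[of "p / (p + q)"])
    fix y assume "y \<in> C"
    then have "(f y, g y) \<in> T" by (auto simp: T_def)
    from above[OF this] have "(p + q) * t \<le> p * f y + q * g y"
      using \<open>(p + q) * t \<le> b\<close> by (simp add: pq)
    then have "t \<le> (p * f y + q * g y) / (p + q)"
      using \<open>p + q > 0\<close> by (simp add: pos_le_divide_eq mult.commute)
    moreover have "1 - p / (p + q) = q / (p + q)"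
      using \<open>p + q > 0\<close> by (simp add: field_simps)
    ultimately show "t \<le> p / (p + q) * f y + (1 - p / (p + q)) * g y"
      by (simp add: add_divide_distrib)
  qed (use \<open>0 \<le> p\<close> \<open>0 \<le> q\<close> \<open>p + q > 0\<close> in auto)
qed

text \<open>Where the new function \<open>f i\<close> is below \<open>t\<close>, one of the old ones
  must reach \<open>t\<close>. That sublevel set inherits the convexity condition, so the induction
  hypothesis on it, rather than on \<open>C\<close>, supplies weights for the old functions. Their
  weighted sum \<open>g\<close> and \<open>f i\<close> then satisfy the two-function case on all of
  \<open>C\<close>.\<close>

lemma finite_minimax:
  fixes f :: "'i \<Rightarrow> 'c \<Rightarrow> real"
  assumes "finite I" "I \<noteq> {}"
    and "\<And>x y a. x \<in> C \<Longrightarrow> y \<in> C \<Longrightarrow> 0 \<le> a \<Longrightarrow> a \<le> 1 \<Longrightarrow>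
      \<exists>z\<in>C. \<forall>i\<in>I. f i z \<le> a * f i x + (1 - a) * f i y"
    and "\<And>x. x \<in> C \<Longrightarrow> \<exists>i\<in>I. t \<le> f i x"
  shows "\<exists>l. (\<forall>i\<in>I. 0 \<le> l i) \<and> (\<Sum>i\<in>I. l i) = 1 \<and> (\<forall>x\<in>C. t \<le> (\<Sum>i\<in>I. l i * f i x))"
  using assms
proof (induction I arbitrary: C rule: finite_ne_induct)
  case (singleton i)
  then show ?case by (intro exI[of _ "\<lambda>_. 1"]) auto
next
  case (insert i I)
  define C' where "C' = {x \<in> C. f i x < t}"
  have "\<exists>l. (\<forall>i\<in>I. 0 \<le> l i) \<and> (\<Sum>i\<in>I. l i) = 1 \<and> (\<forall>x\<in>C'. t \<le> (\<Sum>i\<in>I. l i * f i x))"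
  proof (rule insert.IH)
    fix x y and a :: real
    assume xy: "x \<in> C'" "y \<in> C'" and a: "0 \<le> a" "a \<le> 1"
    then obtain z where z: "z \<in> C" "\<forall>j\<in>insert i I. f j z \<le> a * f j x + (1 - a) * f j y"
      using insert.prems(1)[of x y a] by (auto simp: C'_def)
    have "a * f i x + (1 - a) * f i y < t"
      using xy a by (intro convex_bound_lt) (auto simp: C'_def)
    then have "f i z < t" using z(2) by fastforce
    then show "\<exists>z\<in>C'. \<forall>j\<in>I. f j z \<le> a * f j x + (1 - a) * f j y"
      using z by (auto simp: C'_def)
  next
    fix x assume "x \<in> C'"
    then show "\<exists>j\<in>I. t \<le> f j x"
      using insert.prems(2)[of x] by (auto simp: C'_def)
  qed
  then obtain l where l: "\<And>j. j \<in> I \<Longrightarrow> 0 \<le> l j" "(\<Sum>j\<in>I. l j) = 1"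
    "\<And>x. x \<in> C' \<Longrightarrow> t \<le> (\<Sum>j\<in>I. l j * f j x)" by blast
  define g where "g x = (\<Sum>j\<in>I. l j * f j x)" for x
  obtain m where m: "0 \<le> m" "m \<le> 1" "\<And>x. x \<in> C \<Longrightarrow> t \<le> m * f i x + (1 - m) * g x"
  proof (rule two_function_minimax[of C "f i" g t])
    fix x y and a :: real
    assume xy: "x \<in> C" "y \<in> C" and a: "0 \<le> a" "a \<le> 1"
    then obtain z where z: "z \<in> C" "\<forall>j\<in>insert i I. f j z \<le> a * f j x + (1 - a) * f j y"
      using insert.prems(1)[of x y a] by auto
    have "g z \<le> (\<Sum>j\<in>I. l j * (a * f j x + (1 - a) * f j y))"
      unfolding g_def using z l(1) by (intro sum_mono mult_left_mono) auto
    also have "\<dots> = a * g x + (1 - a) * g y"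
      unfolding g_def sum_distrib_left sum.distrib[symmetric]
      by (intro sum.cong) (auto simp: algebra_simps)
    finally show "\<exists>z\<in>C. f i z \<le> a * f i x + (1 - a) * f i y \<and> g z \<le> a * g x + (1 - a) * g y"
      using z by auto
  next
    fix x assume "x \<in> C"
    then show "t \<le> f i x \<or> t \<le> g x"
      using l(3)[of x] by (cases "f i x < t") (auto simp: C'_def g_def)
  qed blast
  define l' where "l' j = (if j = i then m else (1 - m) * l j)" for j
  have sum': "(\<Sum>j\<in>insert i I. l' j * h j) = m * h i + (1 - m) * (\<Sum>j\<in>I. l j * h j)" for h :: "'i \<Rightarrow> real"
  proof -
    have "(\<Sum>j\<in>I. l' j * h j) = (\<Sum>j\<in>I. (1 - m) * (l j * h j))"
      using insert.hyps by (intro sum.cong) (auto simp: l'_def)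
    then show ?thesis
      using insert.hyps by (simp add: l'_def sum_distrib_left)
  qed
  show ?case
  proof (intro exI[of _ l'] conjI ballI)
    show "0 \<le> l' j" if "j \<in> insert i I" for j using that m l by (auto simp: l'_def)
    show "sum l' (insert i I) = 1" using sum'[of "\<lambda>_. 1"] l(2) by simp
    show "t \<le> (\<Sum>j\<in>insert i I. l' j * f j x)" if "x \<in> C" for x
      using m(3)[OF that] unfolding sum' g_def .
  qed
qed

section \<open>Strong duality\<close>

lemma continuous_on_comp_snd: "continuous_on K v \<Longrightarrow> continuous_on (K \<times> K) (v \<circ> snd)"
  and continuous_on_comp_fst: "continuous_on K v \<Longrightarrow> continuous_on (K \<times> K) (v \<circ> fst)"
  by (rule continuous_on_compose; auto intro!: continuous_intros elim: continuous_on_subset)+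

text \<open>Moves integrals against marginals to the product space, where the weak-* limits of plans
  are taken.\<close>

lemma sint_marg:
  fixes K :: "'a::euclidean_space set"
  assumes K: "compact K" "continuous_on K v" and \<pi>: "\<pi> \<in> pmeasures (K \<times> K)"
  shows "sint K (fst_marg \<pi>) v = sint (K \<times> K) \<pi> (v \<circ> fst)" "fst_marg \<pi> \<in> pmeasures K"
    "sint K (snd_marg \<pi>) v = sint (K \<times> K) \<pi> (v \<circ> snd)" "snd_marg \<pi> \<in> pmeasures K"
proof -
  obtain M where M: "prob_on (K \<times> K) M" "\<pi> = set_fun M"
    using \<pi> by (auto simp: pmeasures_iff)
  have KK: "compact (K \<times> K)" using K by (simp add: compact_Times)
  have c: "- K \<in> sets borel" "- (K \<times> K) \<in> sets borel"
    using K KK by (simp_all add: compact_imp_closed borel_open open_Compl)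
  have cv: "continuous_on (K \<times> K) (v \<circ> fst)" "continuous_on (K \<times> K) (v \<circ> snd)"
    using K(2) by (auto intro: continuous_on_comp_fst continuous_on_comp_snd simp del: comp_apply)
  have m: "fst \<in> borel_measurable (borel :: ('a \<times> 'a) measure)" "snd \<in> borel_measurable (borel :: ('a \<times> 'a) measure)"
    by (auto intro!: borel_measurable_continuous_onI continuous_intros)
  have p: "prob_on K (distr M borel fst)" "prob_on K (distr M borel snd)"
    using M m c by (auto intro!: prob_on_distr[where S="K \<times> K"])
  have eq: "fst_marg \<pi> = set_fun (distr M borel fst)" "snd_marg \<pi> = set_fun (distr M borel snd)"
    using marg_set_fun[of M] M by (auto simp: prob_on_def)
  show "fst_marg \<pi> \<in> pmeasures K" "snd_marg \<pi> \<in> pmeasures K"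
    using p eq by (auto simp: pmeasures_iff)
  show "sint K (fst_marg \<pi>) v = sint (K \<times> K) \<pi> (v \<circ> fst)"
    unfolding eq sint_set_fun[OF K p(1)] unfolding M(2) sint_set_fun[OF KK cv(1) M(1)]
    by (rule integral_distr_cutoff[OF M(1) c(2) m(1) _ K]) auto
  show "sint K (snd_marg \<pi>) v = sint (K \<times> K) \<pi> (v \<circ> snd)"
    unfolding eq sint_set_fun[OF K p(2)] unfolding M(2) sint_set_fun[OF KK cv(2) M(1)]
    by (rule integral_distr_cutoff[OF M(1) c(2) m(2) _ K]) auto
qed

lemma sint_sum:
  fixes S :: "'b::t2_space set"
  assumes S: "compact S" "\<And>i. i \<in> I \<Longrightarrow> continuous_on S (h i)" and \<pi>: "\<pi> \<in> pmeasures S"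
  shows "sint S \<pi> (\<lambda>x. \<Sum>i\<in>I. l i * h i x) = (\<Sum>i\<in>I. l i * sint S \<pi> (h i))"
proof -
  obtain M where M: "prob_on S M" "\<pi> = set_fun M" using \<pi> by (auto simp: pmeasures_iff)
  have c: "continuous_on S (\<lambda>x. \<Sum>i\<in>I. l i * h i x)" by (intro continuous_intros S)
  have "cutoff S (\<lambda>x. \<Sum>i\<in>I. l i * h i x) = (\<lambda>x. \<Sum>i\<in>I. l i * cutoff S (h i) x)"
    by (auto simp: cutoff_def)
  then have "sint S \<pi> (\<lambda>x. \<Sum>i\<in>I. l i * h i x) = (\<Sum>i\<in>I. l i * integral\<^sup>L M (cutoff S (h i)))"
    using M S integrable_cutoff[OF S(1) S(2) M(1)] by (simp add: sint_set_fun c integral_sum)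
  also have "\<dots> = (\<Sum>i\<in>I. l i * sint S \<pi> (h i))"
    using S M by (intro sum.cong) (auto simp: sint_set_fun)
  finally show ?thesis .
qed

lemma sint_determines:
  obtains w :: "nat \<Rightarrow> 'b::{metric_space,second_countable_topology} \<Rightarrow> real"
  where "\<And>k. continuous_on UNIV (w k)"
    "\<And>S \<mu> \<nu>. compact S \<Longrightarrow> \<mu> \<in> pmeasures S \<Longrightarrow> \<nu> \<in> pmeasures S \<Longrightarrow>
      \<forall>k. sint S \<mu> (w k) = sint S \<nu> (w k) \<Longrightarrow> \<mu> = \<nu>"
proof (rule countable_determining_functions)
  fix w :: "nat \<Rightarrow> 'b \<Rightarrow> real"
  assume c: "\<And>k. continuous_on UNIV (w k)"
    and det: "\<And>S M N. compact S \<Longrightarrow> prob_on S M \<Longrightarrow> prob_on S N \<Longrightarrow>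
      (\<And>k. integral\<^sup>L M (cutoff S (w k)) = integral\<^sup>L N (cutoff S (w k))) \<Longrightarrow> M = N"
  show thesis
  proof (rule that[OF c])
    fix S :: "'b set" and \<mu> \<nu>
    assume S: "compact S" and "\<mu> \<in> pmeasures S" "\<nu> \<in> pmeasures S"
      and eq: "\<forall>k. sint S \<mu> (w k) = sint S \<nu> (w k)"
    then obtain M N where M: "prob_on S M" "\<mu> = set_fun M" and N: "prob_on S N" "\<nu> = set_fun N"
      by (auto simp: pmeasures_iff)
    have "integral\<^sup>L M (cutoff S (w k)) = integral\<^sup>L N (cutoff S (w k))" for k
      using eq[rule_format, of k] M N sint_set_fun[OF S continuous_on_subset[OF c]] by simp
    then have "M = N" using det[OF S M(1) N(1)] by simp
    then show "\<mu> = \<nu>" using M N by simp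
  qed
qed

lemma pmeasures_compact_seq:
  fixes S :: "'b::{complete_space,second_countable_topology} set"
  assumes S: "compact S" and p: "\<And>n. p n \<in> pmeasures S"
  obtains r \<pi> where "strict_mono (r :: nat \<Rightarrow> nat)" "\<pi> \<in> pmeasures S"
    "\<And>h. continuous_on S h \<Longrightarrow> (\<lambda>n. sint S (p (r n)) h) \<longlonglongrightarrow> sint S \<pi> h"
proof -
  obtain M where M: "\<And>n. prob_on S (M n)" "\<And>n. p n = set_fun (M n)"
    using p unfolding pmeasures_iff by metis
  obtain r N where "strict_mono (r :: nat \<Rightarrow> nat)" and N: "prob_on S N"
    and lim: "\<And>h. continuous_on S h \<Longrightarrow>
      (\<lambda>n. integral\<^sup>L (M (r n)) (cutoff S h)) \<longlonglongrightarrow> integral\<^sup>L N (cutoff S h)"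
    by (rule prob_on_compact_seq[where M=M, OF S M(1)]) (rule that)
  then show ?thesis
    using M N S by (intro that[of r "set_fun N"]) (auto simp: sint_set_fun pmeasures_iff)
qed

section \<open>Convexity of the set of plans and of the Lagrangian\<close>

lemma mix_couplings1:
  fixes K :: "'a::t2_space set"
  assumes "compact K" and "\<mu> \<in> couplings1 K P" "\<nu> \<in> couplings1 K P" "0 \<le> \<alpha>" "\<alpha> \<le> 1"
  shows "mix \<alpha> \<mu> \<nu> \<in> couplings1 K P"
proof -
  have "compact (K \<times> K)" using assms by (simp add: compact_Times)
  then have c: "- (K \<times> K) \<in> sets borel" by (simp add: compact_imp_closed borel_open open_Compl)
  obtain M N where "prob_on (K \<times> K) M" "\<mu> = set_fun M" "prob_on (K \<times> K) N" "\<nu> = set_fun N"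
    using assms(2,3) by (auto simp: pmeasures_iff couplings1_def)
  with prob_on_mix[OF _ _ assms(4,5) c] have "mix \<alpha> \<mu> \<nu> \<in> pmeasures (K \<times> K)"
    unfolding pmeasures_iff by metis
  moreover have "fst_marg (mix \<alpha> \<mu> \<nu>) A = P A" for A
  proof -
    have "fst_marg \<mu> A = P A" "fst_marg \<nu> A = P A" using assms by (auto simp: couplings1_def)
    then have "fst_marg (mix \<alpha> \<mu> \<nu>) A = \<alpha> * P A + (1 - \<alpha>) * P A"
      by (cases "A \<in> sets borel") (simp_all add: fst_marg_def mix_def)
    then show ?thesis by (simp add: algebra_simps)
  qed
  ultimately show ?thesis by (auto simp: couplings1_def)
qed

text \<open>The minimax lemma is about real functions. This agrees with \<open>Lagr\<close> where
  \<open>F\<close> is finite; elsewhere \<open>real_of_ereal\<close> yields 0 and the value carries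
  no meaning.\<close>

definition rLagr :: "'a::topological_space set \<Rightarrow> ((('a \<times> 'a) set \<Rightarrow> real) \<Rightarrow> ereal) \<Rightarrow> ('a set \<Rightarrow> real)
    \<Rightarrow> ('a \<Rightarrow> real) \<Rightarrow> (('a \<times> 'a) set \<Rightarrow> real) \<Rightarrow> real" where
  "rLagr K F Q v \<pi> = real_of_ereal (F \<pi>) - sint (K \<times> K) \<pi> (v \<circ> snd) + sint K Q v"

lemma couplings1_pmeasures: "\<pi> \<in> couplings1 K P \<Longrightarrow> \<pi> \<in> pmeasures (K \<times> K)"
  by (simp add: couplings1_def)

lemma Lagr_eq_rLagr:
  fixes K :: "'a::euclidean_space set"
  assumes "compact K" "continuous_on K v" "\<pi> \<in> pmeasures (K \<times> K)" "\<bar>F \<pi>\<bar> \<noteq> \<infinity>"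
  shows "Lagr K F Q v \<pi> = ereal (rLagr K F Q v \<pi>)"
  using assms(4) by (auto simp: Lagr_def rLagr_def sint_marg(3)[OF assms(1-3)])

text \<open>The potential terms are affine in the plan, so the modulus of \<open>F\<close> carries
  over. The left side is the extended-real Lagrangian, so the bound itself shows that
  \<open>F\<close> stays below infinity at the mixture. The sign of \<open>\<beta>\<close> is left
  open: the value 0 gives the plain convexity used for duality.\<close>

lemma Lagr_strongly_convex:
  fixes K :: "'a::euclidean_space set"
  assumes K: "compact K" "continuous_on K v"
    and sc: "strongly_convex_sm (couplings1 K P) F \<rho> \<beta>"
    and x: "x \<in> couplings1 K P" "\<bar>F x\<bar> \<noteq> \<infinity>" and y: "y \<in> couplings1 K P" "\<bar>F y\<bar> \<noteq> \<infinity>"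
    and a: "0 \<le> a" "a \<le> 1"
  shows "Lagr K F Q v (mix a x y) \<le> ereal (a * rLagr K F Q v x + (1 - a) * rLagr K F Q v y
    - \<beta> / 2 * a * (1 - a) * (\<rho> x y)\<^sup>2)"
proof -
  have m: "mix a x y \<in> couplings1 K P" using mix_couplings1 K x y a by blast
  have KK: "compact (K \<times> K)" using K by (simp add: compact_Times)
  obtain p q where pq: "F x = ereal p" "F y = ereal q" using x y by (metis ereal_real')
  have "F (mix a x y) \<le> ereal a * F x + ereal (1 - a) * F y - ereal (\<beta> / 2 * a * (1 - a) * (\<rho> x y)\<^sup>2)"
    using sc x y a by (simp add: strongly_convex_sm_def)
  then have "F (mix a x y) \<le> ereal (a * p + (1 - a) * q - \<beta> / 2 * a * (1 - a) * (\<rho> x y)\<^sup>2)"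
    by (simp add: pq)
  moreover have "sint K (snd_marg (mix a x y)) v
      = a * sint (K \<times> K) x (v \<circ> snd) + (1 - a) * sint (K \<times> K) y (v \<circ> snd)"
    using sint_marg(3)[OF K couplings1_pmeasures[OF m]] a x y
      sint_mix[OF KK continuous_on_comp_snd[OF K(2)], of x y a]
    by (simp add: couplings1_pmeasures)
  ultimately show ?thesis
    by (cases "F (mix a x y)") (auto simp: Lagr_def rLagr_def pq algebra_simps)
qed

lemma convex_imp_strongly_convex_0: "convex_sm U F \<Longrightarrow> strongly_convex_sm U F \<rho> 0"
  by (simp add: convex_sm_def strongly_convex_sm_def zero_ereal_def[symmetric])

text \<open>A basic weak-* neighbourhood involves finitely many test functions, so convergence of
  each integral brings the sequence into it eventually.\<close>

lemma wstar_lsc_seq: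
  assumes lsc: "wstar_lsc S F" and "\<pi> \<in> smeasures S" "\<And>n. p n \<in> smeasures S" "t < F \<pi>"
    and lim: "\<And>h. continuous_on S h \<Longrightarrow> (\<lambda>n. sint S (p n) h) \<longlonglongrightarrow> sint S \<pi> h"
  shows "\<forall>\<^sub>F n in sequentially. t < F (p n)"
proof -
  obtain H e where H: "finite H" "\<And>h. h \<in> H \<Longrightarrow> continuous_on S h" "e > 0"
    and *: "\<And>\<nu>. \<nu> \<in> smeasures S \<Longrightarrow> (\<forall>h\<in>H. \<bar>sint S \<nu> h - sint S \<pi> h\<bar> < e) \<Longrightarrow> t < F \<nu>"
    using lsc assms(2,4) unfolding wstar_lsc_def by metis
  have "\<forall>\<^sub>F n in sequentially. \<forall>h\<in>H. \<bar>sint S (p n) h - sint S \<pi> h\<bar> < e"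
    using H tendstoD[OF lim \<open>e > 0\<close>] by (intro eventually_ball_finite) (auto simp: dist_real_def)
  then show ?thesis
    by eventually_elim (use * assms(3) in auto)
qed

text \<open>Turns minimax weights into a single potential. The term with \<open>F\<close> does not
  depend on the potential, which is why the weights have to add up to 1.\<close>

lemma rLagr_sum:
  fixes K :: "'a::euclidean_space set"
  assumes K: "compact K" "\<And>i. i \<in> I \<Longrightarrow> continuous_on K (v i)" and Q: "Q \<in> pmeasures K"
    and \<pi>: "\<pi> \<in> pmeasures (K \<times> K)" and l: "(\<Sum>i\<in>I. l i) = 1"
  shows "rLagr K F Q (\<lambda>y. \<Sum>i\<in>I. l i * v i y) \<pi> = (\<Sum>i\<in>I. l i * rLagr K F Q (v i) \<pi>)"
proof -
  have KK: "compact (K \<times> K)" using K by (simp add: compact_Times)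
  have eq: "(\<lambda>y. \<Sum>i\<in>I. l i * v i y) \<circ> snd = (\<lambda>z. \<Sum>i\<in>I. l i * (v i \<circ> snd) z)" by auto
  have "sint (K \<times> K) \<pi> ((\<lambda>y. \<Sum>i\<in>I. l i * v i y) \<circ> snd) = (\<Sum>i\<in>I. l i * sint (K \<times> K) \<pi> (v i \<circ> snd))"
    unfolding eq by (rule sint_sum[OF KK continuous_on_comp_snd[OF K(2)] \<pi>])
  moreover have "sint K Q (\<lambda>y. \<Sum>i\<in>I. l i * v i y) = (\<Sum>i\<in>I. l i * sint K Q (v i))"
    by (rule sint_sum[OF K Q])
  moreover have "real_of_ereal (F \<pi>) = (\<Sum>i\<in>I. l i * real_of_ereal (F \<pi>))"
    using l by (simp add: sum_distrib_right[symmetric])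
  ultimately show ?thesis
    by (simp add: rLagr_def ring_distribs sum.distrib sum_subtractf)
qed

text \<open>If no potential reached the level \<open>t\<close>, the minimax lemma would provide plans whose Lagrangian is
  below \<open>t\<close> for more and more multiples of the determining functions.  A weak-* limit of these plans
  has second marginal \<open>Q\<close>, because arbitrary multiples of the defect stay bounded, and value at most \<open>t\<close>.\<close>

theorem strong_duality_lower:
  fixes K :: "'a::euclidean_space set"
  assumes K: "compact K" and P: "P \<in> pmeasures K" and Q: "Q \<in> pmeasures K"
    and F: "\<And>\<pi>. \<pi> \<in> smeasures (K \<times> K) \<Longrightarrow> F \<pi> \<noteq> -\<infinity>"
    and conv: "convex_sm (couplings1 K P) F" and lsc: "wstar_lsc (K \<times> K) F"
    and t: "\<And>\<pi>. \<pi> \<in> couplings K P Q \<Longrightarrow> ereal t < F \<pi>"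
  shows "\<exists>v. continuous_on K v \<and> ereal t \<le> (INF \<pi>\<in>couplings1 K P. Lagr K F Q v \<pi>)"
proof (rule ccontr)
  assume contra: "\<not> ?thesis"
  have KK: "compact (K \<times> K)" using K by (simp add: compact_Times)
  have F': "F \<pi> \<noteq> -\<infinity>" if "\<pi> \<in> pmeasures (K \<times> K)" for \<pi>
    using F pmeasures_subset_smeasures that by blast
  define C where "C = {\<pi> \<in> couplings1 K P. F \<pi> < \<infinity>}"
  have C: "\<pi> \<in> couplings1 K P" "\<pi> \<in> pmeasures (K \<times> K)" "\<bar>F \<pi>\<bar> \<noteq> \<infinity>" if "\<pi> \<in> C" for \<pi>
    using that F'[of \<pi>] by (auto simp: C_def couplings1_def)
  obtain w :: "nat \<Rightarrow> 'a \<Rightarrow> real" where wc: "\<And>k. continuous_on UNIV (w k)"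
    and det: "\<And>S \<mu> \<nu>. compact S \<Longrightarrow> \<mu> \<in> pmeasures S \<Longrightarrow> \<nu> \<in> pmeasures S \<Longrightarrow>
      \<forall>k. sint S \<mu> (w k) = sint S \<nu> (w k) \<Longrightarrow> \<mu> = \<nu>"
    by (rule sint_determines) (rule that)
  have wK: "continuous_on K (w k)" for k using wc continuous_on_subset by blast
  define v where "v = (\<lambda>(k, j) y. of_int j * w k y :: real)"
  have vK: "continuous_on K (v i)" for i
    by (cases i) (auto simp: v_def intro!: continuous_intros wK)
  \<comment> \<open>Finite grids that exhaust all pairs of a determining function and an integer
    multiple; the symmetric range provides both signs, and \<open>(0, 0)\<close> is the zero
    potential.\<close>
  define I where "I n = {..n} \<times> {- int n..int n}" for n
  have "\<exists>\<pi>\<in>C. \<forall>i\<in>I n. rLagr K F Q (v i) \<pi> < t" for n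
  proof (rule ccontr)
    assume no: "\<not> ?thesis"
    have "\<exists>l. (\<forall>i\<in>I n. 0 \<le> l i) \<and> (\<Sum>i\<in>I n. l i) = 1 \<and>
        (\<forall>\<pi>\<in>C. t \<le> (\<Sum>i\<in>I n. l i * rLagr K F Q (v i) \<pi>))"
    proof (rule finite_minimax)
      show "finite (I n)" "I n \<noteq> {}" by (auto simp: I_def)
      show "\<exists>i\<in>I n. t \<le> rLagr K F Q (v i) \<pi>" if "\<pi> \<in> C" for \<pi>
        using no that by (auto simp: not_less)
      fix x y and a :: real assume xy: "x \<in> C" "y \<in> C" and a: "0 \<le> a" "a \<le> 1"
      have le: "Lagr K F Q (v i) (mix a x y) \<le> ereal (a * rLagr K F Q (v i) x + (1 - a) * rLagr K F Q (v i) y)" for i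
        using Lagr_strongly_convex[OF K vK convex_imp_strongly_convex_0[OF conv], of x y a Q i "\<lambda>_ _. 0"]
          C[OF xy(1)] C[OF xy(2)] a by simp
      have m: "mix a x y \<in> couplings1 K P" using mix_couplings1 K C xy a by blast
      have "F (mix a x y) < \<infinity>"
        using le[of "(0, 0)"] by (auto simp: Lagr_def)
      then have mC: "mix a x y \<in> C" using m by (simp add: C_def)
      then have "rLagr K F Q (v i) (mix a x y) \<le> a * rLagr K F Q (v i) x + (1 - a) * rLagr K F Q (v i) y" for i
        using le[of i] Lagr_eq_rLagr[where F=F, OF K vK C(2,3), of "mix a x y"] by simp
      then show "\<exists>z\<in>C. \<forall>i\<in>I n. rLagr K F Q (v i) z \<le> a * rLagr K F Q (v i) x + (1 - a) * rLagr K F Q (v i) y"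
        using mC by blast
    qed
    then obtain l where l: "(\<Sum>i\<in>I n. l i) = 1"
      "\<And>\<pi>. \<pi> \<in> C \<Longrightarrow> t \<le> (\<Sum>i\<in>I n. l i * rLagr K F Q (v i) \<pi>)" by blast
    \<comment> \<open>One continuous potential made from the minimax weights: by
      \<open>contra\<close> some plan has Lagrangian below \<open>t\<close> at \<open>u\<close>,
      which contradicts the weighted inequality.\<close>
    define u where "u = (\<lambda>y. \<Sum>i\<in>I n. l i * v i y)"
    have uK: "continuous_on K u" unfolding u_def by (intro continuous_intros vK)
    then obtain \<pi> where \<pi>: "\<pi> \<in> couplings1 K P" "Lagr K F Q u \<pi> < ereal t"
      using contra by (auto simp: not_le INF_less_iff)
    then have "\<pi> \<in> C" by (auto simp: C_def Lagr_def)
    have "rLagr K F Q u \<pi> < t"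
      using \<pi> Lagr_eq_rLagr[where F=F, OF K uK C(2,3)[OF \<open>\<pi> \<in> C\<close>], of Q] by simp
    moreover have "rLagr K F Q u \<pi> = (\<Sum>i\<in>I n. l i * rLagr K F Q (v i) \<pi>)"
      unfolding u_def using K vK Q C(2)[OF \<open>\<pi> \<in> C\<close>] l(1) by (rule rLagr_sum)
    ultimately show False using l(2)[OF \<open>\<pi> \<in> C\<close>] by simp
  qed
  then obtain p where p: "\<And>n. p n \<in> C" "\<And>n i. i \<in> I n \<Longrightarrow> rLagr K F Q (v i) (p n) < t"
    by metis
  obtain r \<pi> where r: "strict_mono (r :: nat \<Rightarrow> nat)" and \<pi>: "\<pi> \<in> pmeasures (K \<times> K)"
    and lim: "\<And>h. continuous_on (K \<times> K) h \<Longrightarrow> (\<lambda>n. sint (K \<times> K) (p (r n)) h) \<longlonglongrightarrow> sint (K \<times> K) \<pi> h"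
    by (rule pmeasures_compact_seq[where p=p, OF KK C(2)[OF p(1)]]) (rule that)
  have "fst_marg \<pi> = P"
  proof (rule det[OF K sint_marg(2)[OF K wK \<pi>] P], rule allI)
    fix k
    have "sint (K \<times> K) (p (r n)) (w k \<circ> fst) = sint K P (w k)" for n
      using sint_marg(1)[OF K wK C(2)[OF p(1)], of "r n" k] C(1)[OF p(1)[of "r n"]]
      by (auto simp: couplings1_def)
    with lim[OF continuous_on_comp_fst[OF wK], of k] have "sint (K \<times> K) \<pi> (w k \<circ> fst) = sint K P (w k)"
      by (simp add: LIMSEQ_const_iff)
    then show "sint K (fst_marg \<pi>) (w k) = sint K P (w k)"
      using sint_marg(1)[OF K wK \<pi>] by simp
  qed
  \<comment> \<open>A fixed index lies in \<open>I (r n)\<close> eventually because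
    \<open>r n \<ge> n\<close>. In the limit lower semicontinuity controls \<open>F\<close>, and the
    integral of the potential converges.\<close>
  have bound: "F \<pi> \<le> ereal (t + sint (K \<times> K) \<pi> (v i \<circ> snd) - sint K Q (v i))" for i
  proof (rule ccontr)
    assume "\<not> ?thesis"
    then obtain c where c: "t + sint (K \<times> K) \<pi> (v i \<circ> snd) - sint K Q (v i) < c" "ereal c < F \<pi>"
      using ereal_dense2[of "ereal (t + sint (K \<times> K) \<pi> (v i \<circ> snd) - sint K Q (v i))" "F \<pi>"]
      by (auto simp: not_le)
    obtain k j where i: "i = (k, j)" by (cases i)
    have "\<forall>\<^sub>F n in sequentially. ereal c < F (p (r n))"
      using lsc pmeasures_subset_smeasures \<pi> C(2)[OF p(1)] c(2) lim
      by (intro wstar_lsc_seq[of "K \<times> K" F \<pi>]) auto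
    moreover have "\<forall>\<^sub>F n in sequentially. i \<in> I (r n)"
    proof -
      have "\<forall>\<^sub>F n in sequentially. max k (nat \<bar>j\<bar>) \<le> n" by (rule eventually_ge_at_top)
      then show ?thesis
      proof eventually_elim
        case (elim n)
        then show ?case using seq_suble[OF r, of n] by (auto simp: I_def i)
      qed
    qed
    ultimately have "\<forall>\<^sub>F n in sequentially. c \<le> t + sint (K \<times> K) (p (r n)) (v i \<circ> snd) - sint K Q (v i)"
    proof eventually_elim
      case (elim n)
      obtain q where "F (p (r n)) = ereal q" using C(3)[OF p(1)] by (metis ereal_real')
      then show ?case using elim(1) p(2)[OF elim(2)] by (simp add: rLagr_def)
    qed
    moreover have "(\<lambda>n. t + sint (K \<times> K) (p (r n)) (v i \<circ> snd) - sint K Q (v i))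
        \<longlonglongrightarrow> t + sint (K \<times> K) \<pi> (v i \<circ> snd) - sint K Q (v i)"
      by (intro tendsto_intros lim continuous_on_comp_snd vK)
    ultimately have "c \<le> t + sint (K \<times> K) \<pi> (v i \<circ> snd) - sint K Q (v i)"
      by (intro tendsto_lowerbound) auto
    with c(1) show False by simp
  qed
  obtain q where q: "F \<pi> = ereal q"
    using bound[of "(0, 0)"] F'[OF \<pi>] by (cases "F \<pi>") auto
  have scale: "sint S \<mu> (\<lambda>x. of_int j * h x) = of_int j * sint S \<mu> h"
    if "compact S" "continuous_on S h" "\<mu> \<in> pmeasures S" for S :: "'b::t2_space set" and \<mu> h j
    using sint_sum[of S "{()}" "\<lambda>_. h" \<mu> "\<lambda>_. of_int j"] that by simp
  define d where "d k = sint K (snd_marg \<pi>) (w k) - sint K Q (w k)" for k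
  have lower: "q - t \<le> of_int j * d k" for j k
  proof -
    have "sint (K \<times> K) \<pi> (v (k, j) \<circ> snd) = of_int j * sint K (snd_marg \<pi>) (w k)"
      using sint_marg(3)[OF K vK \<pi>, of "(k, j)"] scale[OF K wK sint_marg(4)[OF K wK \<pi>]]
      by (simp add: v_def)
    moreover have "sint K Q (v (k, j)) = of_int j * sint K Q (w k)"
      using scale[OF K wK Q] by (simp add: v_def)
    ultimately show ?thesis using bound[of "(k, j)"] q by (simp add: d_def algebra_simps)
  qed
  have "d k = 0" for k
  proof (rule ccontr)
    assume "d k \<noteq> 0"
    obtain n :: nat where n: "\<bar>q - t\<bar> < real n * \<bar>d k\<bar>"
      using reals_Archimedean3[of "\<bar>d k\<bar>"] \<open>d k \<noteq> 0\<close> by auto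
    \<comment> \<open>One of the multiples \<open>n\<close> and \<open>- n\<close> makes the right
      side of \<open>lower\<close> equal to \<open>- n * \<bar>d k\<bar>\<close>, which is below
      \<open>q - t\<close>.\<close>
    show False
      using lower[of "int n" k] lower[of "- int n" k] n by (cases "0 \<le> d k") auto
  qed
  then have "snd_marg \<pi> = Q"
    by (intro det[OF K sint_marg(4)[OF K wK \<pi>] Q]) (simp add: d_def)
  then have "ereal t < F \<pi>"
    using \<pi> \<open>fst_marg \<pi> = P\<close> by (intro t) (simp add: couplings_def)
  moreover have "q \<le> t" using lower[of 0 0] by simp
  ultimately show False using q by simp
qed

section \<open>The duality gap bound\<close>

text \<open>The mixture has weight \<open>d\<close> on a point of excess \<open>e\<close> and
  \<open>1 - d\<close> on one of excess \<open>d\<^sup>2\<close>. Its value is at least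
  \<open>m\<close>, so the convexity gain is at most \<open>d * e + (1 - d) * d\<^sup>2\<close>;
  dividing by \<open>d * (1 - d)\<close> leaves \<open>e / (1 - d) + d\<close>, which tends to
  \<open>e\<close> as \<open>d\<close> tends to 0.\<close>

lemma near_minimizer_bound:
  fixes m e d \<beta> r :: real
  assumes "0 < d" "d < 1" "0 < \<beta>"
    and "m \<le> d * (m + e) + (1 - d) * (m + d\<^sup>2) - \<beta> / 2 * d * (1 - d) * r\<^sup>2"
  shows "r \<le> sqrt (2 / \<beta> * (e / (1 - d) + d))"
proof -
  have "(1 - d) * (e / (1 - d) + d) = e + (1 - d) * d"
    using assms by (simp add: distrib_left)
  then have "d * (1 - d) * (e / (1 - d) + d) = d * (e + (1 - d) * d)"
    by (simp add: mult.assoc)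
  then have "d * (1 - d) * (\<beta> / 2 * r\<^sup>2) \<le> d * (1 - d) * (e / (1 - d) + d)"
    using assms(4) by (simp add: algebra_simps power2_eq_square)
  then have "\<beta> / 2 * r\<^sup>2 \<le> e / (1 - d) + d"
    using assms by (simp add: mult_le_cancel_left)
  then have "r\<^sup>2 \<le> 2 / \<beta> * (e / (1 - d) + d)"
    using assms by (simp add: field_simps)
  then show ?thesis by (rule real_le_rsqrt)
qed

lemma distance_to_near_minimizer:
  fixes K :: "'a::euclidean_space set"
  assumes K: "compact K" "continuous_on K v" and sc: "strongly_convex_sm (couplings1 K P) F \<rho> \<beta>"
    and "0 < \<beta>" "0 < d" "d < 1"
    and m: "\<And>\<pi>. \<pi> \<in> couplings1 K P \<Longrightarrow> ereal m \<le> Lagr K F Q v \<pi>"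
    and x: "x \<in> couplings1 K P" "\<bar>F x\<bar> \<noteq> \<infinity>" "rLagr K F Q v x \<le> m + e"
    and y: "y \<in> couplings1 K P" "\<bar>F y\<bar> \<noteq> \<infinity>" "rLagr K F Q v y \<le> m + d\<^sup>2"
  shows "\<rho> x y \<le> sqrt (2 / \<beta> * (e / (1 - d) + d))"
proof (rule near_minimizer_bound)
  have "ereal m \<le> Lagr K F Q v (mix d x y)"
    using mix_couplings1[OF K(1) x(1) y(1)] assms(5,6) by (intro m) simp
  then have "m \<le> d * rLagr K F Q v x + (1 - d) * rLagr K F Q v y - \<beta> / 2 * d * (1 - d) * (\<rho> x y)\<^sup>2"
    using Lagr_strongly_convex[OF K sc x(1,2) y(1,2), of d Q] assms(5,6) by (meson ereal_less_eq(3) less_imp_le order_trans)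
  moreover have "d * rLagr K F Q v x + (1 - d) * rLagr K F Q v y \<le> d * (m + e) + (1 - d) * (m + d\<^sup>2)"
    using x(3) y(3) assms(5,6) by (intro add_mono mult_left_mono) auto
  ultimately show "m \<le> d * (m + e) + (1 - d) * (m + d\<^sup>2) - \<beta> / 2 * d * (1 - d) * (\<rho> x y)\<^sup>2"
    by linarith
qed (use assms in auto)

theorem theorem3:
  fixes K :: "'a::euclidean_space set"
    and P Q :: "'a set \<Rightarrow> real"
    and F :: "(('a \<times> 'a) set \<Rightarrow> real) \<Rightarrow> ereal"
    and \<rho> :: "(('a \<times> 'a) set \<Rightarrow> real) \<Rightarrow> (('a \<times> 'a) set \<Rightarrow> real) \<Rightarrow> real"
    and \<beta> :: real
    and \<pi>star \<pi>hat :: "('a \<times> 'a) set \<Rightarrow> real"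
    and vhat :: "'a \<Rightarrow> real"
  assumes "compact K"
    and "P \<in> pmeasures K" and "Q \<in> pmeasures K"
    and "\<forall>\<pi>\<in>smeasures (K \<times> K). F \<pi> \<noteq> -\<infinity>"
    and "convex_sm (smeasures (K \<times> K)) F"
    and "wstar_lsc (K \<times> K) F"
    and "sep_star_incr K F"
    and "\<exists>\<pi>\<in>couplings K P Q. F \<pi> < \<infinity>"
    and "metric_on_set (couplings1 K P) \<rho>"
    and "\<beta> > 0"
    and "strongly_convex_sm (couplings1 K P) F \<rho> \<beta>"
    and "\<pi>star \<in> couplings K P Q" and "\<forall>\<pi>\<in>couplings K P Q. F \<pi>star \<le> F \<pi>"
    and "continuous_on K vhat"
    and "\<pi>hat \<in> couplings1 K P"
  shows "ereal (\<rho> \<pi>hat \<pi>star) \<le>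
    ereal (sqrt (2 / \<beta>)) * (esqrt (eps1 K F P Q vhat \<pi>hat) + esqrt (eps2 K F P Q vhat))"
proof -
  note K = assms(1) and P = assms(2) and Q = assms(3) and lsc = assms(6) and met = assms(9)
    and \<beta> = assms(10) and sc = assms(11) and star = assms(12) and opt = assms(13)
    and vhat = assms(14) and hat = assms(15)
  have F: "F \<pi> \<noteq> -\<infinity>" if "\<pi> \<in> couplings1 K P" for \<pi>
    using assms(4) couplings1_pmeasures[OF that] pmeasures_subset_smeasures by blast
  have star1: "\<pi>star \<in> couplings1 K P" and star_snd: "snd_marg \<pi>star = Q"
    using star by (auto simp: couplings_def couplings1_def)
  have conv: "convex_sm (couplings1 K P) F"
    using assms(5) couplings1_pmeasures pmeasures_subset_smeasures unfolding convex_sm_def by blast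
  have Fstar: "\<bar>F \<pi>star\<bar> \<noteq> \<infinity>"
  proof -
    have "F \<pi>star < \<infinity>" using assms(8) opt by (auto intro: le_less_trans)
    then show ?thesis using F[OF star1] by auto
  qed
  then obtain fs where fs: "F \<pi>star = ereal fs" by (metis ereal_real')
  define m where "m = (INF \<pi>\<in>couplings1 K P. Lagr K F Q vhat \<pi>)"
  define D where "D = (SUP v\<in>{v. continuous_on K v}. INF \<pi>\<in>couplings1 K P. Lagr K F Q v \<pi>)"
  \<comment> \<open>Duality yields a potential only for levels strictly below the optimal value, so
    the inequality is reached by approximation from below.\<close>
  have D: "ereal fs \<le> D"
  proof (rule dense_le)
    fix x assume x: "x < ereal fs"
    show "x \<le> D"
    proof (cases x)
      case (real t)
      have "ereal t < F \<pi>" if "\<pi> \<in> couplings K P Q" for \<pi>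
        using x real fs opt that less_le_trans[of "ereal t" "ereal fs" "F \<pi>"] by auto
      then obtain v where "continuous_on K v" "x \<le> (INF \<pi>\<in>couplings1 K P. Lagr K F Q v \<pi>)"
        using strong_duality_lower[OF K P Q _ conv lsc, of t] assms(4) real by blast
      then show ?thesis unfolding D_def by (blast intro: SUP_upper2)
    qed (use x in auto)
  qed
  have Lstar: "Lagr K F Q vhat \<pi>star = ereal fs"
    by (simp add: Lagr_def star_snd fs)
  have mle: "m \<le> Lagr K F Q vhat \<pi>" if "\<pi> \<in> couplings1 K P" for \<pi>
    unfolding m_def using that by (rule INF_lower)
  have eps: "eps1 K F P Q vhat \<pi>hat = Lagr K F Q vhat \<pi>hat - m" "eps2 K F P Q vhat = D - m"
    by (simp_all add: eps1_def eps2_def m_def D_def)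
  have no_mi: "esqrt x \<noteq> -\<infinity>" for x by (auto simp: esqrt_def)
  have triv: ?thesis if "eps1 K F P Q vhat \<pi>hat = \<infinity> \<or> eps2 K F P Q vhat = \<infinity>"
  proof -
    have "esqrt (eps1 K F P Q vhat \<pi>hat) + esqrt (eps2 K F P Q vhat) = \<infinity>"
      using that no_mi by (auto simp: esqrt_def)
    then show ?thesis using \<beta> by (simp only:) simp
  qed
  show ?thesis
  \<comment> \<open>In each of these cases one of the gaps is infinite and so is the right side;
    otherwise all quantities are real.\<close>
  proof (cases "m = -\<infinity> \<or> D = \<infinity> \<or> F \<pi>hat = \<infinity>")
    case True
    have "m \<noteq> \<infinity>" using mle[OF star1] Lstar by auto
    with True have "eps1 K F P Q vhat \<pi>hat = \<infinity> \<or> eps2 K F P Q vhat = \<infinity>"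
      unfolding eps by (cases m; cases D) (auto simp: Lagr_def)
    then show ?thesis by (rule triv)
  next
    case False
    then have Fhat: "\<bar>F \<pi>hat\<bar> \<noteq> \<infinity>" using F[OF hat] by auto
    define lh where "lh = rLagr K F Q vhat \<pi>hat"
    have Lhat: "Lagr K F Q vhat \<pi>hat = ereal lh"
      using Lagr_eq_rLagr[where F=F, OF K vhat couplings1_pmeasures[OF hat] Fhat] by (simp add: lh_def)
    obtain m' where m': "m = ereal m'" using False mle[OF star1] Lstar by (cases m) auto
    obtain D' where D': "D = ereal D'" using False D by (cases D) auto
    define e1 e2 where "e1 = lh - m'" and "e2 = D' - m'"
    have rstar: "rLagr K F Q vhat \<pi>star = fs"
      using Lagr_eq_rLagr[where F=F, OF K vhat couplings1_pmeasures[OF star1] Fstar, of Q] Lstar by simp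
    have step: "\<rho> \<pi>hat \<pi>star \<le> sqrt (2 / \<beta> * (e1 / (1 - d) + d)) + sqrt (2 / \<beta> * (e2 / (1 - d) + d))"
      if d: "0 < d" "d < 1" for d
    proof -
      have "m < ereal (m' + d\<^sup>2)" using d m' by simp
      then obtain y where y: "y \<in> couplings1 K P" "Lagr K F Q vhat y < ereal (m' + d\<^sup>2)"
        unfolding m_def by (auto simp: INF_less_iff)
      have "F y \<noteq> \<infinity>" using y(2) by (auto simp: Lagr_def)
      then have Fy: "\<bar>F y\<bar> \<noteq> \<infinity>" using F[OF y(1)] by auto
      have ly: "rLagr K F Q vhat y \<le> m' + d\<^sup>2"
        using Lagr_eq_rLagr[where F=F, OF K vhat couplings1_pmeasures[OF y(1)] Fy, of Q] y(2) by simp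
      have ml: "ereal m' \<le> Lagr K F Q vhat \<pi>" if "\<pi> \<in> couplings1 K P" for \<pi>
        using mle[OF that] m' by simp
      note near = distance_to_near_minimizer[OF K vhat sc \<beta> d ml _ _ _ y(1) Fy ly]
      have "\<rho> \<pi>hat y \<le> sqrt (2 / \<beta> * (e1 / (1 - d) + d))"
        by (rule near) (use hat Fhat in \<open>auto simp: e1_def lh_def\<close>)
      \<comment> \<open>Here duality enters: the Lagrangian of \<open>\<pi>star\<close> is
        \<open>fs\<close>, and \<open>fs \<le> D' = m' + e2\<close>.\<close>
      moreover have "\<rho> \<pi>star y \<le> sqrt (2 / \<beta> * (e2 / (1 - d) + d))"
        by (rule near) (use star1 Fstar D D' rstar in \<open>auto simp: e2_def\<close>)
      moreover have "\<rho> \<pi>hat \<pi>star \<le> \<rho> \<pi>hat y + \<rho> \<pi>star y"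
        using met hat star1 y(1) unfolding metric_on_set_def by metis
      ultimately show ?thesis by linarith
    qed
    \<comment> \<open>The near-minimizer \<open>y\<close> depends on \<open>d\<close>, but it no
      longer occurs in \<open>step\<close>, so \<open>d\<close> may tend to 0 from the
      right.\<close>
    have "((\<lambda>d. sqrt (2 / \<beta> * (e1 / (1 - d) + d)) + sqrt (2 / \<beta> * (e2 / (1 - d) + d))) \<longlongrightarrow>
        sqrt (2 / \<beta> * (e1 / (1 - 0) + 0)) + sqrt (2 / \<beta> * (e2 / (1 - 0) + 0))) (at_right 0)"
      by (intro tendsto_intros) auto
    moreover have "\<forall>\<^sub>F d in at_right 0. \<rho> \<pi>hat \<pi>star \<le>
        sqrt (2 / \<beta> * (e1 / (1 - d) + d)) + sqrt (2 / \<beta> * (e2 / (1 - d) + d))"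
      using eventually_at_right_real[of 0 1] by (rule eventually_mono) (use step in auto)
    ultimately have "\<rho> \<pi>hat \<pi>star \<le> sqrt (2 / \<beta> * e1) + sqrt (2 / \<beta> * e2)"
      using tendsto_lowerbound by fastforce
    then have "\<rho> \<pi>hat \<pi>star \<le> sqrt (2 / \<beta>) * (sqrt e1 + sqrt e2)"
      by (simp only: real_sqrt_mult distrib_left)
    then show ?thesis
      unfolding eps Lhat m' D' by (simp add: esqrt_def e1_def e2_def)
  qed
qed

end
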